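(* Let $X$ be a $2$-dimensional real Banach space whose unit sphere $S_X$ contains two linearly independent special points. Then $X$ has the Mazur--Ulam property.
   Context: All Banach spaces are over $\mathbb R$; $S_X=\{x\in X:\|x\|=1\}$ denotes the unit sphere of $X$, with the metric $\|x-y\|$. A point $x\in S_X$ is called special if for any bijective isometry $f:S_X\to S_Y$ onto the unit sphere of a Banach space $Y$ and any points $y,z\in S_X$ with $y-z=\|y-z\|\cdot x$ we have $f(y)-f(z)=\|f(y)-f(z)\|\cdot f(x)=\|y-z\|\cdot f(x)$. $X$ has the Mazur--Ulam property if every isometry $f:S_X\to S_Y$ of $S_X$ onto the unit sphere $S_Y$ of an arbitrary Banach space $Y$ extends to a linear isometry of the Banach spaces $X,Y$. *)

theory Defs
  imports "HOL-Analysis.Analysis"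
begin

text \<open>
  The space \<open>X\<close> is a type of class \<^class>\<open>banach\<close>, with unit sphere \<^term>\<open>sphere 0 1\<close>.
  The notions below quantify over all Banach spaces \<open>Y\<close>, also inside a hypothesis, where HOL
  cannot quantify over types. Therefore \<open>Y\<close> is given by a carrier set together with its
  operations; the operations are only constrained on the carrier.
\<close>

record 'b normed_structure =
  carr :: "'b set"
  add :: "'b \<Rightarrow> 'b \<Rightarrow> 'b"
  zero :: "'b"
  smul :: "real \<Rightarrow> 'b \<Rightarrow> 'b"
  nrm :: "'b \<Rightarrow> real"

definition diff :: "'b normed_structure \<Rightarrow> 'b \<Rightarrow> 'b \<Rightarrow> 'b" where
  "diff Y u v = add Y u (smul Y (- 1) v)"

definition real_normed_space :: "'b normed_structure \<Rightarrow> bool" where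
  "real_normed_space Y \<longleftrightarrow>
     zero Y \<in> carr Y \<and>
     (\<forall>u\<in>carr Y. \<forall>v\<in>carr Y. add Y u v \<in> carr Y) \<and>
     (\<forall>a. \<forall>u\<in>carr Y. smul Y a u \<in> carr Y) \<and>
     (\<forall>u\<in>carr Y. \<forall>v\<in>carr Y. \<forall>w\<in>carr Y. add Y (add Y u v) w = add Y u (add Y v w)) \<and>
     (\<forall>u\<in>carr Y. \<forall>v\<in>carr Y. add Y u v = add Y v u) \<and>
     (\<forall>u\<in>carr Y. add Y (zero Y) u = u) \<and>
     (\<forall>u\<in>carr Y. \<exists>v\<in>carr Y. add Y u v = zero Y) \<and>
     (\<forall>a. \<forall>u\<in>carr Y. \<forall>v\<in>carr Y. smul Y a (add Y u v) = add Y (smul Y a u) (smul Y a v)) \<and>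
     (\<forall>a b. \<forall>u\<in>carr Y. smul Y (a + b) u = add Y (smul Y a u) (smul Y b u)) \<and>
     (\<forall>a b. \<forall>u\<in>carr Y. smul Y a (smul Y b u) = smul Y (a * b) u) \<and>
     (\<forall>u\<in>carr Y. smul Y 1 u = u) \<and>
     (\<forall>u\<in>carr Y. 0 \<le> nrm Y u) \<and>
     (\<forall>u\<in>carr Y. nrm Y u = 0 \<longleftrightarrow> u = zero Y) \<and>
     (\<forall>a. \<forall>u\<in>carr Y. nrm Y (smul Y a u) = \<bar>a\<bar> * nrm Y u) \<and>
     (\<forall>u\<in>carr Y. \<forall>v\<in>carr Y. nrm Y (add Y u v) \<le> nrm Y u + nrm Y v)"

definition banach_space :: "'b normed_structure \<Rightarrow> bool" where
  "banach_space Y \<longleftrightarrow> real_normed_space Y \<and>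
     (\<forall>s :: nat \<Rightarrow> 'b. (\<forall>n. s n \<in> carr Y) \<and>
        (\<forall>e>0. \<exists>N. \<forall>m\<ge>N. \<forall>n\<ge>N. nrm Y (diff Y (s m) (s n)) < e) \<longrightarrow>
        (\<exists>l\<in>carr Y. (\<lambda>n. nrm Y (diff Y (s n) l)) \<longlonglongrightarrow> 0))"

lemma banach_space_UNIV:
  "banach_space \<lparr>carr = (UNIV :: 'b::banach set), add = (+), zero = 0, smul = (*\<^sub>R), nrm = norm\<rparr>"
proof -
  have "\<exists>l. (\<lambda>n. norm (s n - l)) \<longlonglongrightarrow> 0"
    if "\<forall>e>0. \<exists>N. \<forall>m\<ge>N. \<forall>n\<ge>N. norm (s m - s n) < e" for s :: "nat \<Rightarrow> 'b"
  proof -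
    have "Cauchy s"
      using that by (intro CauchyI) blast
    then obtain l where "s \<longlonglongrightarrow> l"
      using Cauchy_convergent convergent_def by blast
    then show ?thesis
      using LIM_zero tendsto_norm_zero by blast
  qed
  then show ?thesis
    by (auto simp: banach_space_def real_normed_space_def diff_def algebra_simps
        norm_triangle_ineq intro: exI[of _ "- _"])
qed

definition usphere :: "'b normed_structure \<Rightarrow> 'b set" where
  "usphere Y = {u \<in> carr Y. nrm Y u = 1}"

definition sphere_isometry :: "'b normed_structure \<Rightarrow> ('a::real_normed_vector \<Rightarrow> 'b) \<Rightarrow> bool" where
  "sphere_isometry Y f \<longleftrightarrow> bij_betw f (sphere 0 1) (usphere Y) \<and>
     (\<forall>u\<in>sphere 0 1. \<forall>v\<in>sphere 0 1. nrm Y (diff Y (f u) (f v)) = norm (u - v))"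

definition special_wrt :: "'b normed_structure \<Rightarrow> 'a::real_normed_vector \<Rightarrow> bool" where
  "special_wrt Y x \<longleftrightarrow>
     (\<forall>f. sphere_isometry Y f \<longrightarrow>
        (\<forall>y\<in>sphere 0 1. \<forall>z\<in>sphere 0 1. y - z = norm (y - z) *\<^sub>R x \<longrightarrow>
           diff Y (f y) (f z) = smul Y (nrm Y (diff Y (f y) (f z))) (f x) \<and>
           smul Y (nrm Y (diff Y (f y) (f z))) (f x) = smul Y (norm (y - z)) (f x)))"

text \<open>
  Here \<open>Y\<close> ranges over all Banach spaces whose carrier is a subset of the type of \<open>X\<close>.
  This is no restriction: if there is a bijection between the unit spheres of \<open>X\<close> and \<open>Y\<close>,
  then its homogeneous extension is a bijection between \<open>X\<close> and \<open>Y\<close>, along which \<open>Y\<close> can be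
  copied to the type of \<open>X\<close>. See the theorem \<open>special_imp_special_wrt\<close> below.
\<close>

definition special :: "'a::real_normed_vector \<Rightarrow> bool" where
  "special x \<longleftrightarrow> x \<in> sphere 0 1 \<and>
     (\<forall>Y :: 'a normed_structure. banach_space Y \<longrightarrow> special_wrt Y x)"

definition linear_isometry :: "'b normed_structure \<Rightarrow> ('a::real_normed_vector \<Rightarrow> 'b) \<Rightarrow> bool" where
  "linear_isometry Y F \<longleftrightarrow> bij_betw F UNIV (carr Y) \<and>
     (\<forall>u v. F (u + v) = add Y (F u) (F v)) \<and>
     (\<forall>a u. F (a *\<^sub>R u) = smul Y a (F u)) \<and>
     (\<forall>u. nrm Y (F u) = norm u)"

text \<open>
  The spaces \<open>Y\<close> have their carriers in the type \<open>'b\<close>. Being a free type variable of the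
  theorem, \<open>'b\<close> is arbitrary.
\<close>

definition mazur_ulam_property :: "'a::real_normed_vector itself \<Rightarrow> 'b itself \<Rightarrow> bool" where
  "mazur_ulam_property _ _ \<longleftrightarrow>
     (\<forall>(Y :: 'b normed_structure) (f :: 'a \<Rightarrow> 'b). banach_space Y \<and> sphere_isometry Y f \<longrightarrow>
        (\<exists>F. linear_isometry Y F \<and> (\<forall>u\<in>sphere 0 1. F u = f u)))"

definition transport :: "('b \<Rightarrow> 'c) \<Rightarrow> 'b normed_structure \<Rightarrow> 'c normed_structure" where
  "transport g Y = (let h = inv_into (carr Y) g in
     \<lparr>carr = g ` carr Y,
      add = (\<lambda>a b. g (add Y (h a) (h b))),
      zero = g (zero Y),
      smul = (\<lambda>r a. g (smul Y r (h a))),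
      nrm = (\<lambda>a. nrm Y (h a))\<rparr>)"

lemma transport_simps:
  assumes "inj_on g (carr Y)"
  shows "carr (transport g Y) = g ` carr Y"
    and "zero (transport g Y) = g (zero Y)"
    and "\<And>u v. u \<in> carr Y \<Longrightarrow> v \<in> carr Y \<Longrightarrow> add (transport g Y) (g u) (g v) = g (add Y u v)"
    and "\<And>r u. u \<in> carr Y \<Longrightarrow> smul (transport g Y) r (g u) = g (smul Y r u)"
    and "\<And>u. u \<in> carr Y \<Longrightarrow> nrm (transport g Y) (g u) = nrm Y u"
  using assms by (auto simp: transport_def Let_def)

lemma banach_space_closed:
  assumes "banach_space Y"
  shows "zero Y \<in> carr Y"
    and "\<And>u v. u \<in> carr Y \<Longrightarrow> v \<in> carr Y \<Longrightarrow> add Y u v \<in> carr Y"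
    and "\<And>a u. u \<in> carr Y \<Longrightarrow> smul Y a u \<in> carr Y"
    and "\<And>u v. u \<in> carr Y \<Longrightarrow> v \<in> carr Y \<Longrightarrow> diff Y u v \<in> carr Y"
  using assms unfolding banach_space_def real_normed_space_def diff_def by auto

lemma diff_transport:
  assumes "inj_on g (carr Y)" "banach_space Y" "u \<in> carr Y" "v \<in> carr Y"
  shows "diff (transport g Y) (g u) (g v) = g (diff Y u v)"
  using assms by (simp add: diff_def transport_simps banach_space_closed)

lemma banach_space_transport:
  assumes inj: "inj_on g (carr Y)" and Y: "banach_space Y"
  shows "banach_space (transport g Y)"
proof -
  note ts = transport_simps[OF inj] and cl = banach_space_closed[OF Y]
  have ns: "real_normed_space Y"
    using Y by (simp add: banach_space_def)
  have assoc: "\<forall>u\<in>carr Y. \<forall>v\<in>carr Y. \<forall>w\<in>carr Y.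
      add Y (add Y u v) w = add Y u (add Y v w)"
    using ns unfolding real_normed_space_def by (elim conjE)
  have "real_normed_space (transport g Y)"
    unfolding real_normed_space_def ts(1,2) ball_simps bex_simps
  proof (intro conjI ballI allI)
    fix u assume u: "u \<in> carr Y"
    show "nrm (transport g Y) (g u) = 0 \<longleftrightarrow> g u = g (zero Y)"
      using u cl ns inj by (auto simp: ts real_normed_space_def inj_on_eq_iff)
    show "add (transport g Y) (g (zero Y)) (g u) = g u"
      using u cl(1) ns by (auto simp only: ts real_normed_space_def)
    show "add (transport g Y) (add (transport g Y) (g u) (g v)) (g w) =
        add (transport g Y) (g u) (add (transport g Y) (g v) (g w))"
      if "v \<in> carr Y" "w \<in> carr Y" for v w
      using u that by (simp add: ts cl assoc)
    show "\<exists>v\<in>carr Y. add (transport g Y) (g u) (g v) = g (zero Y)"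
      using u ns unfolding real_normed_space_def by (metis ts(3))
  qed (use ns cl in \<open>simp_all add: ts real_normed_space_def\<close>)
  moreover have "\<exists>l\<in>carr (transport g Y).
      (\<lambda>n. nrm (transport g Y) (diff (transport g Y) (s n) l)) \<longlonglongrightarrow> 0"
    if s: "\<forall>n. s n \<in> carr (transport g Y)"
      and C: "\<forall>e>0. \<exists>N. \<forall>m\<ge>N. \<forall>n\<ge>N.
        nrm (transport g Y) (diff (transport g Y) (s m) (s n)) < e" for s :: "nat \<Rightarrow> _"
  proof -
    have "\<forall>n. \<exists>u. u \<in> carr Y \<and> s n = g u"
      using s by (auto simp: ts)
    then obtain t where t: "\<And>n. t n \<in> carr Y" "\<And>n. s n = g (t n)"
      by metis
    have nt: "nrm (transport g Y) (diff (transport g Y) (g u) (g v)) = nrm Y (diff Y u v)"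
      if "u \<in> carr Y" "v \<in> carr Y" for u v
      using that by (simp add: diff_transport[OF inj Y] ts cl)
    have "\<forall>e>0. \<exists>N. \<forall>m\<ge>N. \<forall>n\<ge>N. nrm Y (diff Y (t m) (t n)) < e"
      using C t by (simp add: nt)
    then obtain l where "l \<in> carr Y" "(\<lambda>n. nrm Y (diff Y (t n) l)) \<longlonglongrightarrow> 0"
      using Y t(1) unfolding banach_space_def by blast
    then show ?thesis
      using t by (intro bexI[of _ "g l"]) (simp_all add: nt ts)
  qed
  ultimately show ?thesis
    unfolding banach_space_def by blast
qed

lemma special_wrt_transport:
  fixes x :: "'a::real_normed_vector"
  assumes inj: "inj_on g (carr Y)" and Y: "banach_space Y" and x: "x \<in> sphere 0 1"
    and special: "special_wrt (transport g Y) x"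
  shows "special_wrt Y x"
  unfolding special_wrt_def
proof (intro allI impI ballI)
  note ts = transport_simps[OF inj] and cl = banach_space_closed[OF Y]
  fix f :: "'a \<Rightarrow> 'b" and y z :: 'a
  assume f: "sphere_isometry Y f" and yz: "y \<in> sphere 0 1" "z \<in> sphere 0 1"
    and xyz: "y - z = norm (y - z) *\<^sub>R x"
  have bij: "bij_betw f (sphere 0 1) (usphere Y)"
    using f by (simp add: sphere_isometry_def)
  have fc: "f u \<in> carr Y" if "u \<in> sphere 0 1" for u
    using bij_betwE[OF bij] that by (auto simp: usphere_def)
  have "bij_betw g (usphere Y) (usphere (transport g Y))"
    unfolding bij_betw_def
  proof
    show "inj_on g (usphere Y)"
      using inj by (rule inj_on_subset) (auto simp: usphere_def)
    show "g ` usphere Y = usphere (transport g Y)"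
      by (auto simp: usphere_def ts)
  qed
  then have "bij_betw (g \<circ> f) (sphere 0 1) (usphere (transport g Y))"
    using bij by (rule bij_betw_trans[rotated])
  then have "sphere_isometry (transport g Y) (g \<circ> f)"
    using f fc by (simp add: sphere_isometry_def diff_transport[OF inj Y] ts cl del: mem_sphere_0)
  then have "g (diff Y (f y) (f z)) = g (smul Y (nrm Y (diff Y (f y) (f z))) (f x))"
    "g (smul Y (nrm Y (diff Y (f y) (f z))) (f x)) = g (smul Y (norm (y - z)) (f x))"
    using special yz xyz x fc unfolding special_wrt_def
    by (fastforce simp: diff_transport[OF inj Y] ts cl simp del: mem_sphere_0)+
  then show "diff Y (f y) (f z) = smul Y (nrm Y (diff Y (f y) (f z))) (f x) \<and>
      smul Y (nrm Y (diff Y (f y) (f z))) (f x) = smul Y (norm (y - z)) (f x)"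
    using inj by (intro conjI) (erule (1) inj_onD; intro cl fc yz x)+
qed

lemma sphere_bij_imp_inj:
  fixes f :: "'a::real_normed_vector \<Rightarrow> 'b"
  assumes Y: "banach_space Y" and f: "bij_betw f (sphere 0 1) (usphere Y)"
  shows "\<exists>g :: 'b \<Rightarrow> 'a. inj_on g (carr Y)"
proof
  let ?h = "inv_into (sphere 0 1) f"
  let ?d = "\<lambda>v. smul Y (1 / nrm Y v) v"
  let ?g = "\<lambda>v. nrm Y v *\<^sub>R ?h (?d v)"
  note cl = banach_space_closed[OF Y]
  have ns: "real_normed_space Y"
    using Y by (simp add: banach_space_def)
  have d: "?d v \<in> usphere Y" if "v \<in> carr Y" "nrm Y v \<noteq> 0" for v
    using that ns cl by (auto simp: usphere_def real_normed_space_def)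
  have h: "?h u \<in> sphere 0 1" if "u \<in> usphere Y" for u
    using bij_betwE[OF bij_betw_inv_into[OF f]] that by blast
  have n: "norm (?g v) = nrm Y v" if "v \<in> carr Y" for v
    using h[OF d[OF that]] that ns by (cases "nrm Y v = 0") (auto simp: real_normed_space_def)
  have rescale: "smul Y (nrm Y v) (?d v) = v" if "v \<in> carr Y" "nrm Y v \<noteq> 0" for v
    using that ns by (simp add: real_normed_space_def)
  show "inj_on ?g (carr Y)"
  proof (rule inj_onI)
    fix v w assume vw: "v \<in> carr Y" "w \<in> carr Y" and eq: "?g v = ?g w"
    have nvw: "nrm Y v = nrm Y w"
      using n[OF vw(1)] n[OF vw(2)] eq by simp
    show "v = w"
    proof (cases "nrm Y w = 0")
      case True
      then show ?thesis
        using nvw vw ns by (simp add: real_normed_space_def)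
    next
      case False
      then have "?h (?d v) = ?h (?d w)"
        using eq nvw by simp
      then have "?d v = ?d w"
        using inj_onD[OF bij_betw_imp_inj_on[OF bij_betw_inv_into[OF f]]] d vw nvw False by metis
      then show ?thesis
        using rescale vw nvw False by metis
    qed
  qed
qed

theorem special_imp_special_wrt:
  fixes x :: "'a::real_normed_vector" and Y :: "'b normed_structure"
  assumes x: "special x" and Y: "banach_space Y"
  shows "special_wrt Y x"
proof (cases "\<exists>f :: 'a \<Rightarrow> 'b. sphere_isometry Y f")
  case True
  then obtain g :: "'b \<Rightarrow> 'a" where "inj_on g (carr Y)"
    using sphere_bij_imp_inj[OF Y] unfolding sphere_isometry_def by blast
  then show ?thesis
    using x Y banach_space_transport special_wrt_transport unfolding special_def by blast
qed (simp add: special_wrt_def)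

end

theory Submission
  imports Defs
begin

text \<open>
  Let \<open>e1\<close>, \<open>e2\<close> be the special points and \<open>f\<close> an isometry onto the unit sphere of \<open>Y\<close>. By
  connectedness \<open>Y\<close> is the plane spanned by \<open>f e1\<close> and \<open>f e2\<close>, so in coordinates \<open>f\<close> becomes an
  isometry \<open>h\<close> between the unit circles of two norms \<open>M\<close>, \<open>N\<close> on the plane that fixes
  \<open>(1, 0)\<close> and \<open>(0, 1)\<close> and moves the two ends of a horizontal or vertical chord by the same
  vector. We have to show that \<open>h\<close> is the identity.

  All horizontal chords have direction \<open>(1, 0)\<close>, so the first-order change of the length of a
  chord, when one end is moved up, is given by the one-sided supporting functional at \<open>(1, 0)\<close>.
  Since \<open>h\<close> preserves these lengths and is monotone in the height, \<open>x + \<beta> y\<close> at \<open>h p\<close> equals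
  \<open>x + \<alpha> y\<close> at \<open>p\<close>, where \<open>\<alpha>\<close> and \<open>\<beta>\<close> are the slopes of the supporting functionals of
  \<open>M\<close> and \<open>N\<close>. The same holds with the coordinates exchanged. If the segments from \<open>(1, 0)\<close> to
  \<open>(0, 1)\<close> and to \<open>(0, - 1)\<close> are not contained in the unit circle of \<open>M\<close>, the two functionals
  are independent, and \<open>h p = p\<close>.

  In the remaining case \<open>h\<close> fixes such a segment pointwise, and the displacement \<open>h p - p\<close> is
  invariant under passing to the other end of a horizontal or vertical chord. An extremal point
  of a level set of the length of the displacement has no other point of the circle at its
  height. There is only one such point, although a nonzero displacement would produce infinitely
  many nonempty level sets.
\<close>

section \<open>Norms on Euclidean spaces and on the plane\<close>

text \<open>Norms are plain functions here, since different norms on one and the same space have to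
  be compared.\<close>

locale norm_function =
  fixes M :: "'e::euclidean_space \<Rightarrow> real"
  assumes triangle: "M (p + q) \<le> M p + M q"
    and scale: "M (c *\<^sub>R p) = \<bar>c\<bar> * M p"
    and definite: "M p = 0 \<Longrightarrow> p = 0"
begin

lemma zero: "M 0 = 0"
  using scale[of 0 0] by simp

lemma minus: "M (- p) = M p"
  using scale[of "- 1" p] by simp

lemma nonneg: "0 \<le> M p"
  using triangle[of p "- p"] by (simp add: minus zero)

lemma pos: "p \<noteq> 0 \<Longrightarrow> 0 < M p"
  using nonneg[of p] definite[of p] by force

lemma convex_comb:
  assumes "0 \<le> s" "0 \<le> t"
  shows "M (s *\<^sub>R p + t *\<^sub>R q) \<le> s * M p + t * M q"
  using triangle[of "s *\<^sub>R p" "t *\<^sub>R q"] assms by (simp add: scale)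

lemma continuous: "continuous_on A M"
proof -
  have "convex_on UNIV M"
    unfolding convex_on_def by (auto intro!: convex_comb)
  then have "continuous_on UNIV M"
    by (simp add: convex_on_continuous)
  then show ?thesis
    using continuous_on_subset by blast
qed

text \<open>The constant is the minimum of \<open>M\<close> on the compact Euclidean unit sphere;
  homogeneity carries the bound to all vectors.\<close>

lemma coercive: obtains c where "0 < c" "\<And>p. c * norm p \<le> M p"
proof -
  have "sphere (0 :: 'e) 1 \<noteq> {}"
    by (metis norm_Basis SOME_Basis mem_sphere_0 empty_iff)
  then obtain x where x: "x \<in> sphere 0 1" "\<And>y. y \<in> sphere 0 1 \<Longrightarrow> M x \<le> M y"
    using continuous_attains_inf[OF compact_sphere _ continuous] by metis
  show ?thesis
  proof
    show "0 < M x"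
      using x(1) by (intro pos) auto
    show "M x * norm p \<le> M p" for p
    proof (cases "p = 0")
      case False
      have "M x \<le> M (p /\<^sub>R norm p)"
        using False by (intro x(2)) simp
      then show ?thesis
        using False by (simp add: scale field_simps)
    qed (simp add: zero)
  qed
qed

lemma normalize: "p \<noteq> 0 \<Longrightarrow> M (p /\<^sub>R M p) = 1"
  using pos[of p] by (simp add: scale)

lemma lt_one_between:
  assumes "M p < 1" "M q \<le> 1" "0 < t" "t < 1"
  shows "M ((1 - t) *\<^sub>R p + t *\<^sub>R q) < 1"
proof -
  have "M ((1 - t) *\<^sub>R p + t *\<^sub>R q) \<le> (1 - t) * M p + t * M q"
    using assms by (intro convex_comb) auto
  also have "\<dots> < (1 - t) * 1 + t * 1"
    using assms by (intro add_less_le_mono mult_strict_left_mono mult_left_mono) auto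
  finally show ?thesis by simp
qed

lemma continuous_normalize:
  assumes "continuous_on A P" "\<And>r. r \<in> A \<Longrightarrow> P r \<noteq> 0"
  shows "continuous_on A (\<lambda>r. P r /\<^sub>R M (P r))"
proof -
  have "continuous_on A (\<lambda>r. M (P r))"
    by (rule continuous_on_compose2[OF continuous[of UNIV] assms(1)]) simp
  then show ?thesis
    using assms pos by (intro continuous_intros) (auto dest!: definite)
qed

end

text \<open>Coercivity of \<open>N\<close> bounds the Euclidean length of \<open>h q - h p\<close>
  by a multiple of \<open>M (q - p)\<close>, which tends to 0.\<close>

lemma norm_isometry_continuous:
  assumes "norm_function M" "norm_function N"
    and iso: "\<And>p q. p \<in> A \<Longrightarrow> q \<in> A \<Longrightarrow> N (h p - h q) = M (p - q)"
  shows "continuous_on A h"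
proof -
  interpret M: norm_function M by fact
  interpret N: norm_function N by fact
  obtain c where c: "0 < c" "\<And>p. c * norm p \<le> N p"
    using N.coercive by blast
  have "(h \<longlongrightarrow> h p) (at p within A)" if p: "p \<in> A" for p
  proof -
    have "((\<lambda>q. M (q - p) / c) \<longlongrightarrow> M (p - p) / c) (at p within A)"
    proof -
      have "continuous_on A (\<lambda>q. M (q - p) / c)"
        using c(1) by (intro continuous_intros continuous_on_compose2[OF M.continuous[of UNIV]]) auto
      then show ?thesis
        using p unfolding continuous_on by blast
    qed
    then have "((\<lambda>q. M (q - p) / c) \<longlongrightarrow> 0) (at p within A)"
      by (simp add: M.zero)
    moreover have "\<forall>\<^sub>F q in at p within A. norm (h q - h p) \<le> M (q - p) / c"
      unfolding eventually_at_filter using c iso p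
      by (auto intro!: always_eventually simp: field_simps) (metis c(2) mult.commute)
    ultimately have "((\<lambda>q. h q - h p) \<longlongrightarrow> 0) (at p within A)"
      by (rule Lim_null_comparison[rotated])
    then show ?thesis
      by (simp add: LIM_zero_iff)
  qed
  then show ?thesis
    by (simp add: continuous_on)
qed

text \<open>The largest point of \<open>{a..b}\<close> at which \<open>g\<close> does not exceed
  \<open>g a\<close> must be \<open>b\<close>, as the local condition would otherwise yield a larger
  one. This turns one-sided first-order estimates into global ones.\<close>

lemma right_local_nonincreasing:
  fixes g :: "real \<Rightarrow> real"
  assumes "a \<le> b" and cont: "continuous_on {a..b} g"
    and loc: "\<And>u. a \<le> u \<Longrightarrow> u < b \<Longrightarrow> \<forall>\<^sub>F v in at_right u. g v \<le> g u"
  shows "g b \<le> g a"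
proof -
  let ?A = "{x \<in> {a..b}. g x \<le> g a}"
  have "compact ?A"
  proof -
    have "closed ({a..b} \<inter> g -` {..g a})"
      using cont by (intro continuous_closed_preimage) auto
    moreover have "?A = {a..b} \<inter> ({a..b} \<inter> g -` {..g a})"
      by auto
    ultimately show ?thesis
      using compact_Int_closed[OF compact_Icc] by metis
  qed
  moreover have "a \<in> ?A"
    using assms(1) by simp
  ultimately obtain x where x: "x \<in> ?A" "\<And>y. y \<in> ?A \<Longrightarrow> y \<le> x"
    using compact_attains_sup[of ?A] by blast
  have "x = b"
  proof (rule ccontr)
    assume "x \<noteq> b"
    then have "a \<le> x" "x < b"
      using x(1) by auto
    then have "\<forall>\<^sub>F v in at_right x. g v \<le> g x \<and> v \<in> {x<..<b}"
      using loc by (intro eventually_conj eventually_at_right_real) auto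
    then obtain v where "g v \<le> g x" "v \<in> {x<..<b}"
      using eventually_happens'[of "at_right x"] by auto
    then show False
      using x(1) x(2)[of v] by auto
  qed
  then show ?thesis
    using x by simp
qed

section \<open>Norms on the plane: slopes and horizontal lines\<close>

locale plane_norm = norm_function M for M :: "real \<times> real \<Rightarrow> real"
begin

text \<open>\<open>\<alpha>\<close> is the right derivative at 0 of the convex function sending
  \<open>t\<close> to \<open>M (1, t)\<close>, that is, the infimum of its difference quotients.
  Hence it is also a subgradient, and homogeneity gives the estimates for
  \<open>M (c, d)\<close>.\<close>

lemma slope:
  assumes one: "M (1, 0) = 1"
  obtains \<alpha> where "\<And>c d. 0 < c \<Longrightarrow> c + \<alpha> * d \<le> M (c, d)"
    and "\<And>\<epsilon>. 0 < \<epsilon> \<Longrightarrow> \<exists>r>0. \<forall>c d. 0 < c \<longrightarrow> 0 \<le> d \<longrightarrow> d \<le> r * c \<longrightarrow> M (c, d) \<le> c + (\<alpha> + \<epsilon>) * d"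
proof -
  let ?q = "\<lambda>t. M (1, t)"
  let ?Q = "(\<lambda>t. (?q t - 1) / t) ` {0<..}"
  define \<alpha> where "\<alpha> = Inf ?Q"
  have sc: "M (c, d) = c * ?q (d / c)" if "0 < c" for c d
    using scale[of c "(1, d / c)"] that by simp
  have "- M (0, 1) \<le> (?q t - 1) / t" if "0 < t" for t
  proof -
    have "M (1, 0) \<le> ?q t + M (- t *\<^sub>R (0, 1))"
      using triangle[of "(1, t)" "- t *\<^sub>R (0, 1)"] by simp
    then show ?thesis
      using that by (simp only: scale one) (simp add: field_simps)
  qed
  then have bdd: "bdd_below ?Q"
    by (intro bdd_belowI) auto
  have lowpos: "1 + \<alpha> * t \<le> ?q t" if "0 \<le> t" for t
  proof (cases "t = 0")
    case False
    then have "\<alpha> \<le> (?q t - 1) / t"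
      using that unfolding \<alpha>_def by (intro cInf_lower bdd) auto
    then show ?thesis
      using that False by (simp add: field_simps)
  qed (simp add: one)
  have up: "\<exists>r>0. \<forall>t. 0 \<le> t \<and> t \<le> r \<longrightarrow> ?q t \<le> 1 + (\<alpha> + \<epsilon>) * t" if "0 < \<epsilon>" for \<epsilon>
  proof -
    have "\<exists>x\<in>?Q. x < \<alpha> + \<epsilon>"
      using that unfolding \<alpha>_def by (intro cInf_lessD) auto
    then obtain r where r: "0 < r" "(?q r - 1) / r < \<alpha> + \<epsilon>"
      by auto
    have "?q t \<le> 1 + (\<alpha> + \<epsilon>) * t" if "0 \<le> t" "t \<le> r" for t
    proof -
      have "?q t \<le> (1 - t / r) * 1 + t / r * ?q r"
        using convex_comb[of "1 - t / r" "t / r" "(1, 0)" "(1, r)"] that r(1) one by simp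
      also have "\<dots> = 1 + t * ((?q r - 1) / r)"
        using r(1) by (simp add: field_simps)
      also have "\<dots> \<le> 1 + t * (\<alpha> + \<epsilon>)"
        using r(2) that by (intro add_left_mono mult_left_mono) auto
      finally show ?thesis
        by (simp add: mult.commute)
    qed
    then show ?thesis
      using r(1) by blast
  qed
  have low: "1 + \<alpha> * t \<le> ?q t" for t
  proof (cases "0 \<le> t")
    case False
    \<comment> \<open>For negative \<open>t\<close> the point (1, 0) lies between (1, t) and (1, r).
      Convexity and the upper bound at a small positive \<open>r\<close> give the estimate; the
      slack \<open>e / (- t)\<close> becomes exactly \<open>e\<close> after rescaling.\<close>
    have "1 + \<alpha> * t \<le> ?q t + e" if "0 < e" for e
    proof -
      have "0 < e / (- t)"
        using False that by (intro divide_pos_pos) auto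
      then obtain r where r: "0 < r" "?q r \<le> 1 + (\<alpha> + e / (- t)) * r"
        using up by (meson less_eq_real_def order_refl)
      have "(r - t) *\<^sub>R (1, 0) = (- t) *\<^sub>R (1, r) + r *\<^sub>R (1 :: real, t)"
        by (simp add: algebra_simps)
      then have "(r - t) * 1 \<le> (- t) * ?q r + r * ?q t"
        using convex_comb[of "- t" r "(1, r)" "(1, t)"] scale[of "r - t" "(1, 0)"] one False r(1)
        by simp
      also have "\<dots> \<le> (- t) * (1 + (\<alpha> + e / (- t)) * r) + r * ?q t"
        using r(2) False by (intro add_right_mono mult_left_mono) auto
      also have "(- t) * (1 + (\<alpha> + e / (- t)) * r) = - t - \<alpha> * t * r + e * r"
        using False by (simp add: field_simps)
      finally have "r * (1 + \<alpha> * t) \<le> r * (?q t + e)"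
        by (simp add: algebra_simps)
      then show ?thesis
        using r(1) by simp
    qed
    then show ?thesis
      by (rule field_le_epsilon)
  qed (rule lowpos)
  show ?thesis
  proof
    show "c + \<alpha> * d \<le> M (c, d)" if "0 < c" for c d
    proof -
      have "c * (1 + \<alpha> * (d / c)) \<le> c * ?q (d / c)"
        using that low[of "d / c"] by (intro mult_left_mono) (auto simp del: times_divide_eq_right)
      then show ?thesis
        using that sc[of c d] by (simp add: algebra_simps)
    qed
    show "\<exists>r>0. \<forall>c d. 0 < c \<longrightarrow> 0 \<le> d \<longrightarrow> d \<le> r * c \<longrightarrow> M (c, d) \<le> c + (\<alpha> + \<epsilon>) * d"
      if \<epsilon>: "0 < \<epsilon>" for \<epsilon>
    proof -
      obtain r where r: "0 < r" "\<And>t. 0 \<le> t \<Longrightarrow> t \<le> r \<Longrightarrow> ?q t \<le> 1 + (\<alpha> + \<epsilon>) * t"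
        using up[OF \<epsilon>] by blast
      have "M (c, d) \<le> c + (\<alpha> + \<epsilon>) * d" if "0 < c" "0 \<le> d" "d \<le> r * c" for c d
      proof -
        have "c * ?q (d / c) \<le> c * (1 + (\<alpha> + \<epsilon>) * (d / c))"
          using that r(2)[of "d / c"] by (intro mult_left_mono) (auto simp: field_simps)
        also have "\<dots> = c + (\<alpha> + \<epsilon>) * d"
          using that by (simp add: field_simps)
        finally show ?thesis
          using that sc[of c d] by simp
      qed
      then show ?thesis
        using r(1) by blast
    qed
  qed
qed

text \<open>Otherwise \<open>p\<close> could be scaled down to a point at height \<open>b\<close>
  inside the open unit disc.\<close>

lemma height_bound:
  assumes "\<And>x. 1 \<le> M (x, b)" "M p \<le> 1"
  shows "\<bar>snd p\<bar> \<le> \<bar>b\<bar>"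
proof (rule ccontr)
  assume "\<not> ?thesis"
  then have *: "\<bar>b / snd p\<bar> < 1"
    by (simp add: abs_divide divide_less_eq)
  have "1 \<le> M (b / snd p * fst p, b)"
    by (rule assms(1))
  also have "(b / snd p * fst p, b) = (b / snd p) *\<^sub>R p"
    using \<open>\<not> \<bar>snd p\<bar> \<le> \<bar>b\<bar>\<close> by (cases p) auto
  also have "M \<dots> = \<bar>b / snd p\<bar> * M p"
    by (rule scale)
  also have "\<dots> \<le> \<bar>b / snd p\<bar> * 1"
    using assms(2) by (intro mult_left_mono) auto
  finally show False
    using * by simp
qed

lemma horizontal_between:
  assumes "M (x, b) < 1" "M (z, b) \<le> 1" "x < y \<and> y < z \<or> z < y \<and> y < x"
  shows "M (y, b) < 1"
proof -
  let ?t = "(y - x) / (z - x)"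
  have "M ((1 - ?t) *\<^sub>R (x, b) + ?t *\<^sub>R (z, b)) < 1"
    using assms by (intro lt_one_between) (auto simp: field_simps)
  moreover have "(1 - ?t) *\<^sub>R (x, b) + ?t *\<^sub>R (z, b) = (y, b)"
  proof -
    have "z \<noteq> x"
      using assms(3) by auto
    then have "?t * (z - x) = y - x"
      by simp
    moreover have "(1 - t) *\<^sub>R (x, b) + t *\<^sub>R (z, b) = (x + t * (z - x), b)" for t
      by (simp add: algebra_simps)
    ultimately show ?thesis
      by (simp only:) simp
  qed
  ultimately show ?thesis
    by simp
qed

text \<open>If the line met the open disc at \<open>w\<close>, two of the three points would lie on
  the same side of \<open>w\<close>, and by convexity the nearer one would be inside the
  disc.\<close>

lemma three_on_horizontal:
  assumes "M (x, b) = 1" "M (y, b) = 1" "M (z, b) = 1" "x \<noteq> y" "y \<noteq> z" "x \<noteq> z"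
  shows "1 \<le> M (w, b)"
proof (rule ccontr)
  assume "\<not> 1 \<le> M (w, b)"
  then have w: "M (w, b) < 1" by simp
  then have "w \<noteq> x" "w \<noteq> y" "w \<noteq> z"
    using assms by auto
  then obtain u v where "M (u, b) = 1" "M (v, b) = 1" "w < u \<and> u < v \<or> v < u \<and> u < w"
    using assms by (smt (verit))
  then show False
    using horizontal_between[OF w, of v u] by simp
qed

end

section \<open>Isometries of unit circles that respect horizontal and vertical chords\<close>

text \<open>\<open>M\<close> and \<open>N\<close> stand for the norms of \<open>X\<close> and
  \<open>Y\<close> in coordinates along the special points and along their images;
  \<open>horizontal\<close> and \<open>vertical\<close> are what specialness of the two points says
  about \<open>h\<close>.\<close>

locale plane_isometry = M: plane_norm M + N: plane_norm N for M N +
  fixes h :: "real \<times> real \<Rightarrow> real \<times> real"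
  assumes unit1: "M (1, 0) = 1" and unit2: "M (0, 1) = 1"
    and h_unit: "M p = 1 \<Longrightarrow> N (h p) = 1"
    and iso: "M p = 1 \<Longrightarrow> M q = 1 \<Longrightarrow> N (h p - h q) = M (p - q)"
    and h1: "h (1, 0) = (1, 0)" and h2: "h (0, 1) = (0, 1)"
    and horizontal: "M (a, b) = 1 \<Longrightarrow> M (a', b) = 1 \<Longrightarrow> h (a, b) - h (a', b) = (a - a', 0)"
    and vertical: "M (a, b) = 1 \<Longrightarrow> M (a, b') = 1 \<Longrightarrow> h (a, b) - h (a, b') = (0, b - b')"
begin

lemma continuous_h: "continuous_on {p. M p = 1} h"
  by (rule norm_isometry_continuous[where M = M and N = N])
    (use iso M.norm_function_axioms N.norm_function_axioms in auto)

lemma inj_h: "M p = 1 \<Longrightarrow> M q = 1 \<Longrightarrow> h p = h q \<Longrightarrow> p = q"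
  using iso[of p q] M.definite[of "p - q"] by (simp add: N.zero)

lemma M_minus_units: "M (-1, 0) = 1" "M (0, -1) = 1"
  using M.minus[of "(1, 0)"] M.minus[of "(0, 1)"] unit1 unit2 by simp_all

lemma h_minus_units: "h (-1, 0) = (-1, 0)" "h (0, -1) = (0, -1)"
  using horizontal[of 1 0 "-1"] vertical[of 0 1 "-1"] h1 h2 unit1 unit2 M_minus_units
  by (auto simp: prod_eq_iff)

lemma N_units: "N (1, 0) = 1" "N (0, 1) = 1"
  using h_unit[OF unit1] h_unit[OF unit2] h1 h2 by simp_all

section \<open>Symmetries: exchanging the coordinates and reflecting in the origin\<close>

lemma swap:
  "plane_isometry (\<lambda>p. M (prod.swap p)) (\<lambda>p. N (prod.swap p)) (\<lambda>p. prod.swap (h (prod.swap p)))"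
proof -
  have lin: "prod.swap (p + q) = prod.swap p + prod.swap q"
    "prod.swap (p - q) = prod.swap p - prod.swap q"
    "prod.swap (c *\<^sub>R p) = c *\<^sub>R prod.swap p"
    for p q :: "real \<times> real" and c
    by (simp_all add: prod_eq_iff)
  have swap_zero: "prod.swap p = 0 \<Longrightarrow> p = 0" for p :: "real \<times> real"
    by (auto simp: prod_eq_iff)
  have norm: "plane_norm (\<lambda>p. K (prod.swap p))" if "plane_norm K" for K
  proof -
    interpret plane_norm K by fact
    show ?thesis
      by unfold_locales (simp_all only: lin triangle scale, rule swap_zero[OF definite])
  qed
  have "N (prod.swap (prod.swap (h (prod.swap p)) - prod.swap (h (prod.swap q)))) = M (prod.swap (p - q))"
    if "M (prod.swap p) = 1" "M (prod.swap q) = 1" for p q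
    using iso[OF that] by (simp only: lin swap_swap)
  then show ?thesis
    by (intro plane_isometry.intro plane_isometry_axioms.intro norm M.plane_norm_axioms N.plane_norm_axioms)
      (simp_all only: swap_swap swap_simp unit1 unit2 h1 h2 h_unit horizontal vertical flip: lin(2))
qed

text \<open>It is not known in advance that \<open>h\<close> is odd. Conjugating with the point
  reflection transfers results to opposite points.\<close>

lemma reflect_origin: "plane_isometry M N (\<lambda>p. - h (- p))"
proof -
  have "N (- h (- p) + h (- q)) = M (p - q)" if "M p = 1" "M q = 1" for p q
    using iso[of "- q" "- p"] that by (simp add: M.minus)
  moreover have "- h (- a, - b) + h (- a', - b) = (a - a', 0)"
    if "M (a, b) = 1" "M (a', b) = 1" for a b a'
    using horizontal[of "- a'" "- b" "- a"] that M.minus[of "(a, b)"] M.minus[of "(a', b)"] by simp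
  moreover have "- h (- a, - b) + h (- a, - b') = (0, b - b')"
    if "M (a, b) = 1" "M (a, b') = 1" for a b b'
    using vertical[of "- a" "- b'" "- b"] that M.minus[of "(a, b)"] M.minus[of "(a, b')"] by simp
  ultimately show ?thesis
    by unfold_locales (use unit1 unit2 h_unit in \<open>auto simp: h_minus_units N.minus M.minus\<close>)
qed

lemma continuous_h_path:
  assumes "continuous_on A P" "\<And>r. r \<in> A \<Longrightarrow> P r \<noteq> 0"
  shows "continuous_on A (\<lambda>r. h (P r /\<^sub>R M (P r)))"
proof (rule continuous_on_compose2[OF continuous_h M.continuous_normalize[OF assms]])
  show "(\<lambda>r. P r /\<^sub>R M (P r)) ` A \<subseteq> {p. M p = 1}"
    using assms(2) M.normalize by blast
qed

text \<open>The only points of height 0 on the circle of \<open>N\<close> are (1, 0) and (- 1, 0);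
  they are their own images, and \<open>h\<close> is injective.\<close>

lemma height_eq_zero:
  assumes p: "M p = 1" and "snd (h p) = 0"
  shows "snd p = 0"
proof -
  define x where "x = fst (h p)"
  have hp: "h p = (x, 0)"
    using assms by (simp add: x_def prod_eq_iff)
  then have "\<bar>x\<bar> = 1"
    using h_unit[OF p] N.scale[of x "(1, 0)"] N_units by simp
  then have "h p = h (1, 0) \<or> h p = h (- 1, 0)"
    using hp h1 h_minus_units by (auto simp: abs_if split: if_splits)
  then have "p = (1, 0) \<or> p = (- 1, 0)"
    using inj_h p unit1 M_minus_units by blast
  then show ?thesis
    by auto
qed

text \<open>The segment from \<open>p\<close> to (0, 1), projected radially to the circle, stays
  above the horizontal axis. By \<open>height_eq_zero\<close> the height of the image never vanishes
  along it, and it is 1 at the end.\<close>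

lemma height_pos:
  assumes p: "M p = 1" "0 < snd p"
  shows "0 < snd (h p)"
proof (rule ccontr)
  assume neg: "\<not> 0 < snd (h p)"
  define P where "P r = (1 - r) *\<^sub>R p + (0, r)" for r :: real
  have snd_P: "0 < snd (P r)" if "r \<in> {0..1}" for r
    using that p(2) mult_nonneg_nonneg[of "1 - r" "snd p"]
    by (cases "r = 0") (auto simp: P_def intro: add_nonneg_pos)
  then have P0: "P r \<noteq> 0" if "r \<in> {0..1}" for r
    using that by force
  let ?k = "\<lambda>r. snd (h (P r /\<^sub>R M (P r)))"
  have "continuous_on {0..1} ?k"
    using P0 by (intro continuous_on_snd continuous_h_path) (auto simp: P_def intro!: continuous_intros)
  moreover have "P 0 = p" "P 1 = (0, 1)"
    by (simp_all add: P_def prod_eq_iff)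
  then have "?k 0 \<le> 0" "0 \<le> ?k 1"
    using neg p unit2 h2 by simp_all
  ultimately obtain r where r: "0 \<le> r" "r \<le> 1" "?k r = 0"
    using IVT'[of ?k 0 0 1] by auto
  then have r': "r \<in> {0..1}"
    by simp
  have "snd (P r /\<^sub>R M (P r)) = 0"
    using M.normalize[OF P0[OF r']] r(3) by (rule height_eq_zero)
  moreover have "snd (P r /\<^sub>R M (P r)) = snd (P r) / M (P r)"
    by (simp add: divide_inverse_commute)
  ultimately show False
    using snd_P[OF r'] M.pos[OF P0[OF r']] by simp
qed

lemma height_neg:
  assumes p: "M p = 1" "snd p < 0"
  shows "snd (h p) < 0"
proof -
  interpret neg: plane_isometry M N "\<lambda>p. - h (- p)"
    by (rule reflect_origin)
  show ?thesis
    using neg.height_pos[of "- p"] p by (simp add: M.minus)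
qed

text \<open>
  The horizontal line at height \<^term>\<open>u\<close> with \<^term>\<open>u \<in> heights\<close> meets the unit circle of
  \<^term>\<open>M\<close> in exactly two points, namely at the abscissae \<open>right u\<close> and \<open>- right (- u)\<close>.
\<close>

definition heights :: "real set" where
  "heights = {u. \<exists>a. M (a, u) < 1}"

definition right :: "real \<Rightarrow> real" where
  "right u = Sup {a. M (a, u) \<le> 1}"

section \<open>Right ends of the horizontal chords\<close>

lemma abscissa_bdd: "bdd_above {a. M (a, u) \<le> 1}"
proof -
  obtain c where c: "0 < c" "\<And>p. c * norm p \<le> M p"
    using M.coercive by blast
  have "a \<le> 1 / c" if "M (a, u) \<le> 1" for a
  proof -
    have "c * \<bar>a\<bar> \<le> c * norm (a, u)"
      using c(1) norm_fst_le[of a u] by (intro mult_left_mono) auto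
    also have "\<dots> \<le> 1"
      using c(2)[of "(a, u)"] that by linarith
    finally have "\<bar>a\<bar> \<le> 1 / c"
      using c(1) by (simp add: field_simps)
    then show ?thesis
      by simp
  qed
  then show ?thesis
    by (intro bdd_aboveI) auto
qed

lemma le_right: "M (a, u) \<le> 1 \<Longrightarrow> a \<le> right u"
  unfolding right_def by (intro cSup_upper abscissa_bdd) auto

lemma continuous_abscissa: "continuous_on A (\<lambda>a. M (a, u))"
  by (rule continuous_on_compose2[OF M.continuous[of UNIV]]) (auto intro!: continuous_intros)

lemma M_right:
  assumes "u \<in> heights"
  shows "M (right u, u) = 1"
proof -
  have "closed {a. M (a, u) \<le> 1}"
    by (intro closed_Collect_le continuous_abscissa continuous_intros)
  moreover have "{a. M (a, u) \<le> 1} \<noteq> {}"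
    using assms by (auto simp: heights_def intro: less_imp_le)
  ultimately have le: "M (right u, u) \<le> 1"
    using closed_contains_Sup[OF _ abscissa_bdd] unfolding right_def by blast
  have "\<not> M (right u, u) < 1"
  proof
    assume "M (right u, u) < 1"
    moreover have "open {a. M (a, u) < 1}"
      by (intro open_Collect_less continuous_abscissa continuous_intros)
    ultimately obtain e where e: "0 < e" "ball (right u) e \<subseteq> {a. M (a, u) < 1}"
      by (metis mem_Collect_eq openE)
    then have "right u + e / 2 \<in> {a. M (a, u) < 1}"
      by (intro subsetD[OF e(2)]) (auto simp: dist_real_def)
    then show False
      using le_right[of "right u + e / 2" u] e(1) by simp
  qed
  then show ?thesis
    using le by simp
qed

lemma minus_heights:
  assumes "u \<in> heights"
  shows "- u \<in> heights"
proof -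
  obtain a where "M (a, u) < 1"
    using assms by (auto simp: heights_def)
  then have "M (- a, - u) < 1"
    using M.minus[of "(a, u)"] by simp
  then show ?thesis
    by (auto simp: heights_def)
qed

lemma M_left: "u \<in> heights \<Longrightarrow> M (- right (- u), u) = 1"
  using M_right[OF minus_heights] M.minus[of "(right (- u), - u)"] by simp

lemma left_less_right:
  assumes "u \<in> heights"
  shows "- right (- u) < right u"
proof -
  obtain a where a: "M (a, u) < 1"
    using assms by (auto simp: heights_def)
  then have "M (- a, - u) < 1"
    using M.minus[of "(a, u)"] by simp
  then have "- right (- u) \<le> a" "a \<le> right u"
    using a le_right[of a u] le_right[of "- a" "- u"] by auto
  moreover have "a \<noteq> right u"
    using a M_right[OF assms] by auto
  ultimately show ?thesis
    by simp
qed

lemma zero_in_heights: "0 \<in> heights"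
  unfolding heights_def using M.zero by (auto simp: zero_prod_def intro!: exI[of _ 0])

lemma right_zero: "right 0 = 1"
proof -
  have "{a. M (a, 0) \<le> 1} = {- 1..1}"
    using M.scale[of _ "(1, 0)"] unit1 by (auto simp: abs_le_iff)
  then show ?thesis
    by (simp add: right_def)
qed

lemma open_heights: "open heights"
proof -
  have "heights = (\<Union>a. {u. M (a, u) < 1})"
    by (auto simp: heights_def)
  moreover have "open {u. M (a, u) < 1}" for a
    by (intro open_Collect_less continuous_intros continuous_on_compose2[OF M.continuous[of UNIV]]) auto
  ultimately show ?thesis
    by auto
qed

lemma convex_heights: "convex heights"
proof (rule convexI)
  fix u v s t :: real
  assume "u \<in> heights" "v \<in> heights" and st: "0 \<le> s" "0 \<le> t" "s + t = 1"
  then obtain a b where ab: "M (a, u) < 1" "M (b, v) < 1"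
    by (auto simp: heights_def)
  have "M (s *\<^sub>R (a, u) + t *\<^sub>R (b, v)) < 1"
    using M.convex_comb[OF st(1,2), of "(a, u)" "(b, v)"] ab convex_bound_lt[OF ab st] by simp
  then show "s *\<^sub>R u + t *\<^sub>R v \<in> heights"
    by (auto simp: heights_def)
qed

text \<open>By convexity of the unit disc, \<open>right\<close> is concave on the open set
  \<open>heights\<close>.\<close>

lemma continuous_right: "continuous_on heights right"
proof -
  have "convex_on heights (\<lambda>u. - right u)"
  proof (intro convex_onI convex_heights)
    fix t u v :: real
    assume t: "0 < t" "t < 1" and uv: "u \<in> heights" "v \<in> heights"
    have "M ((1 - t) *\<^sub>R (right u, u) + t *\<^sub>R (right v, v)) \<le> (1 - t) * 1 + t * 1"
      using M.convex_comb[of "1 - t" t "(right u, u)" "(right v, v)"] t uv by (simp add: M_right)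
    then have "(1 - t) * right u + t * right v \<le> right ((1 - t) * u + t * v)"
      by (intro le_right) simp
    then show "- right ((1 - t) *\<^sub>R u + t *\<^sub>R v) \<le> (1 - t) * - right u + t * - right v"
      by simp
  qed
  then have "continuous_on heights (\<lambda>u. - (- right u))"
    by (intro continuous_on_minus convex_on_continuous open_heights)
  then show ?thesis
    by simp
qed

lemma continuous_h_right: "continuous_on heights (\<lambda>u. h (right u, u))"
  by (rule continuous_on_compose2[OF continuous_h])
    (auto intro!: continuous_intros continuous_right M_right)

section \<open>Monotonicity of the height of the image\<close>

lemma height_extremal:
  assumes "M p = 1" "M q = 1" "M r = 1" "p \<noteq> q" "q \<noteq> r" "p \<noteq> r"
    and "snd (h p) = v" "snd (h q) = v" "snd (h r) = v" and "M s = 1"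
  shows "\<bar>snd (h s)\<bar> \<le> \<bar>v\<bar>"
proof (rule N.height_bound)
  obtain x y z where xyz: "h p = (x, v)" "h q = (y, v)" "h r = (z, v)"
    using assms by (metis prod.collapse)
  then have "x \<noteq> y" "y \<noteq> z" "x \<noteq> z"
    using assms inj_h by metis+
  then show "1 \<le> N (w, v)" for w
    using xyz h_unit assms(1-3) by (intro N.three_on_horizontal[of x v y z]) metis+
  show "N (h s) \<le> 1"
    using h_unit assms by simp
qed

text \<open>By \<open>horizontal\<close>, both ends of the chord at height \<open>u\<close> have
  images at height \<open>v\<close>. The right end of the chord at height \<open>w\<close> is a
  third such point.\<close>

lemma height_eq_extremal:
  assumes "u \<in> heights" "w \<in> heights" "u \<noteq> w"
    and "snd (h (right u, u)) = v" "snd (h (right w, w)) = v" and "M s = 1"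
  shows "\<bar>snd (h s)\<bar> \<le> \<bar>v\<bar>"
proof (rule height_extremal[where p = "(right u, u)" and q = "(right w, w)" and r = "(- right (- u), u)"])
  have "h (right u, u) - h (- right (- u), u) = (right u + right (- u), 0)"
    using horizontal[OF M_right M_left] assms by simp
  then show "snd (h (- right (- u), u)) = v"
    using assms by (auto simp: prod_eq_iff)
qed (use assms left_less_right[of u] in \<open>auto simp: M_right M_left\<close>)

lemma heights_between:
  assumes "u \<in> heights" "w \<in> heights"
  shows "{u..w} \<subseteq> heights"
  using convex_heights assms by (meson connected_contains_Icc convex_connected)

lemma h_right_zero: "h (right 0, 0) = (1, 0)"
  by (simp add: right_zero h1)

text \<open>
  If monotonicity failed, some value would be attained at two heights, hence at three points of
  the circle, and so would be extremal, although it lies strictly between two other values.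
\<close>

lemma height_mono:
  assumes uw: "u \<in> heights" "w \<in> heights" "u \<le> w"
  shows "snd (h (right u, u)) \<le> snd (h (right w, w))"
proof (rule ccontr)
  let ?\<phi> = "\<lambda>u. snd (h (right u, u))"
  assume "\<not> ?thesis"
  then have less: "?\<phi> w < ?\<phi> u"
    by simp
  have cont: "continuous_on {x..y} ?\<phi>" if "x \<in> heights" "y \<in> heights" for x y
    using heights_between[OF that] continuous_h_right
    by (intro continuous_on_snd) (auto intro: continuous_on_subset)
  have 0: "?\<phi> 0 = 0"
    by (simp add: h_right_zero)
  have pos: "0 < ?\<phi> x" if "x \<in> heights" "0 < x" for x
    using that height_pos[of "(right x, x)"] by (simp add: M_right)
  have neg: "?\<phi> x < 0" if "x \<in> heights" "x < 0" for x
    using that height_neg[of "(right x, x)"] by (simp add: M_right)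
  define v where "v = (?\<phi> u + ?\<phi> w) / 2"
  have v: "?\<phi> w < v" "v < ?\<phi> u"
    using less by (auto simp: v_def)
  \<comment> \<open>Since \<open>h\<close> preserves the sign of heights, \<open>u\<close> and
    \<open>w\<close> do not lie on different sides of 0. In either case \<open>v\<close> is attained
    once between \<open>u\<close> and \<open>w\<close> and once between 0 and the one of them that
    is nearer to 0.\<close>
  consider "0 \<le> u" | "w \<le> 0"
    using less 0 pos[OF uw(2)] neg[OF uw(1)] by force
  then show False
  proof cases
    case 1
    then have w0: "0 < ?\<phi> w"
      using uw less pos[OF uw(2)] by (cases "u = w") auto
    obtain x where x: "0 \<le> x" "x \<le> u" "?\<phi> x = v"
      using IVT'[of ?\<phi> 0 v u] v w0 0 1 cont[OF zero_in_heights uw(1)] by force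
    obtain y where y: "u \<le> y" "y \<le> w" "?\<phi> y = v"
      using IVT2'[of ?\<phi> w v u] v uw cont[OF uw(1,2)] by force
    have "x \<in> heights" "y \<in> heights" "x \<noteq> y"
      using x y v uw heights_between zero_in_heights by (fastforce)+
    then have "\<bar>?\<phi> u\<bar> \<le> \<bar>v\<bar>"
      using x y uw by (intro height_eq_extremal[of x y]) (auto simp: M_right)
    then show False
      using v w0 by simp
  next
    case 2
    then have w0: "?\<phi> u < 0"
      using uw less neg[OF uw(1)] by (cases "u = w") auto
    obtain x where x: "u \<le> x" "x \<le> w" "?\<phi> x = v"
      using IVT2'[of ?\<phi> w v u] v uw cont[OF uw(1,2)] by force
    obtain y where y: "w \<le> y" "y \<le> 0" "?\<phi> y = v"
      using IVT'[of ?\<phi> w v 0] v w0 0 2 cont[OF uw(2) zero_in_heights] by force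
    have "x \<in> heights" "y \<in> heights" "x \<noteq> y"
      using x y v uw heights_between zero_in_heights by (fastforce)+
    then have "\<bar>?\<phi> w\<bar> \<le> \<bar>v\<bar>"
      using x y uw by (intro height_eq_extremal[of x y]) (auto simp: M_right)
    then show False
      using v w0 by simp
  qed
qed

end

section \<open>Supporting functionals along horizontal chords\<close>

lemma (in plane_norm) le_sum_abs:
  assumes "M (1, 0) = 1" "M (0, 1) = 1"
  shows "M (a, b) \<le> \<bar>a\<bar> + \<bar>b\<bar>"
proof -
  have "M (a *\<^sub>R (1, 0) + b *\<^sub>R (0, 1)) \<le> M (a *\<^sub>R (1, 0)) + M (b *\<^sub>R (0, 1))"
    by (rule triangle)
  then show ?thesis
    by (simp only: scale assms) simp
qed

text \<open>The vector \<open>(m, m)\<close> has norm \<open>2 * m\<close>, and its difference to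
  \<open>(a, b)\<close> has nonnegative coordinates, hence norm at most their sum.\<close>

lemma (in plane_norm) flat_ge_sum:
  assumes "M (1, 0) = 1" "M (0, 1) = 1" "M (1, 1) = 2"
  shows "a + b \<le> M (a, b)"
proof -
  define m where "m = max \<bar>a\<bar> \<bar>b\<bar>"
  have "M (m *\<^sub>R (1, 1)) \<le> M (a, b) + M (m - a, m - b)"
    using triangle[of "(a, b)" "(m - a, m - b)"] by simp
  moreover have "M (m - a, m - b) \<le> (m - a) + (m - b)"
    using le_sum_abs[OF assms(1,2), of "m - a" "m - b"] by (simp add: m_def)
  moreover have "M (m *\<^sub>R (1, 1)) = 2 * m"
    by (simp only: scale assms) (simp add: m_def)
  ultimately show ?thesis
    by simp
qed

lemma (in plane_norm) flat_quadrant: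
  assumes "M (1, 0) = 1" "M (0, 1) = 1" "M (1, 1) = 2" "0 \<le> a" "0 \<le> b"
  shows "M (a, b) = a + b"
  using flat_ge_sum[OF assms(1-3), of a b] le_sum_abs[OF assms(1,2), of a b] assms by simp

text \<open>Equality in the triangle inequality for \<open>p\<close> and \<open>e\<close> survives
  rescaling of \<open>e\<close>: a smaller norm for some \<open>k\<close> would, after adding the
  missing multiple of \<open>e\<close> or of \<open>p\<close>, contradict it.\<close>

lemma (in norm_function) add_multiple:
  assumes "M p = 1" "M e = 1" "M (p + e) = 2" "0 \<le> k"
  shows "M (p + k *\<^sub>R e) = 1 + k"
proof (rule antisym)
  show "M (p + k *\<^sub>R e) \<le> 1 + k"
    using triangle[of p "k *\<^sub>R e"] assms by (simp add: scale)
  show "1 + k \<le> M (p + k *\<^sub>R e)"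
  proof (cases "k \<le> 1")
    case True
    have "M (p + e) \<le> M (p + k *\<^sub>R e) + M ((1 - k) *\<^sub>R e)"
      using triangle[of "p + k *\<^sub>R e" "(1 - k) *\<^sub>R e"] by (simp add: algebra_simps)
    then show ?thesis
      using True assms by (simp add: scale)
  next
    case False
    have "M (k *\<^sub>R (p + e)) \<le> M (p + k *\<^sub>R e) + M ((k - 1) *\<^sub>R p)"
      using triangle[of "p + k *\<^sub>R e" "(k - 1) *\<^sub>R p"] by (simp add: algebra_simps)
    then show ?thesis
      using False assms by (simp add: scale)
  qed
qed

section \<open>The first-order argument and the case without segments\<close>

context plane_isometry
begin

lemma other_abscissa:
  assumes "M (x, u) < 1"
  shows "\<exists>y. y \<noteq> a \<and> M (y, u) = 1"
proof -
  have "u \<in> heights"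
    using assms by (auto simp: heights_def)
  then show ?thesis
    using M_right[of u] M_left[of u] left_less_right[of u] by (metis less_irrefl)
qed

lemma other_ordinate:
  assumes "M (u, x) < 1"
  shows "\<exists>y. y \<noteq> a \<and> M (u, y) = 1"
proof -
  interpret swap: plane_isometry "\<lambda>p. M (prod.swap p)" "\<lambda>p. N (prod.swap p)" "\<lambda>p. prod.swap (h (prod.swap p))"
    by (rule swap)
  show ?thesis
    using swap.other_abscissa[of x u a] assms by simp
qed

text \<open>
  First-order expansion, at each height, of the equality between the lengths of the segment from
  the left end of the chord at height \<^term>\<open>u\<close> to the right end of a slightly higher chord and
  of its image; \<^term>\<open>\<alpha>\<close> and \<^term>\<open>\<beta>\<close> are the slopes of the two norms at the direction of
  the chords.
\<close>

lemma horizontal_functional: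
  obtains \<alpha> \<beta> where "\<And>c d. 0 < c \<Longrightarrow> c + \<alpha> * d \<le> M (c, d)"
    and "\<And>p. M p = 1 \<Longrightarrow> fst (h p) + \<beta> * snd (h p) = fst p + \<alpha> * snd p"
proof -
  obtain \<alpha> where \<alpha>: "\<And>c d. 0 < c \<Longrightarrow> c + \<alpha> * d \<le> M (c, d)"
    "\<And>\<epsilon>. 0 < \<epsilon> \<Longrightarrow> \<exists>r>0. \<forall>c d. 0 < c \<longrightarrow> 0 \<le> d \<longrightarrow> d \<le> r * c \<longrightarrow> M (c, d) \<le> c + (\<alpha> + \<epsilon>) * d"
    using M.slope[OF unit1] by blast
  obtain \<beta> where \<beta>: "\<And>c d. 0 < c \<Longrightarrow> c + \<beta> * d \<le> N (c, d)"
    "\<And>\<epsilon>. 0 < \<epsilon> \<Longrightarrow> \<exists>r>0. \<forall>c d. 0 < c \<longrightarrow> 0 \<le> d \<longrightarrow> d \<le> r * c \<longrightarrow> N (c, d) \<le> c + (\<beta> + \<epsilon>) * d"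
    using N.slope[OF N_units(1)] by blast
  define X where "X u = fst (h (right u, u))" for u
  define \<phi> where "\<phi> u = snd (h (right u, u))" for u
  \<comment> \<open>\<open>G\<close> measures the failure of the claimed identity at right ends of
    chords. It vanishes at height 0, where \<open>h\<close> fixes (1, 0), and turns out to be
    constant.\<close>
  define G where "G u = X u + \<beta> * \<phi> u - right u - \<alpha> * u" for u
  have contX: "continuous_on heights X" and cont\<phi>: "continuous_on heights \<phi>"
    unfolding X_def \<phi>_def by (intro continuous_on_fst continuous_on_snd continuous_h_right)+
  have contG: "continuous_on heights G"
    unfolding G_def by (intro continuous_intros contX cont\<phi> continuous_right)
  have local: "\<forall>\<^sub>F v in at_right u. \<bar>G v - G u\<bar> \<le> \<epsilon> * (v + \<phi> v - (u + \<phi> u))"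
    if u: "u \<in> heights" and \<epsilon>: "0 < \<epsilon>" for u \<epsilon>
  proof -
    obtain r where r: "0 < r"
      "\<And>c d. 0 < c \<Longrightarrow> 0 \<le> d \<Longrightarrow> d \<le> r * c \<Longrightarrow> M (c, d) \<le> c + (\<alpha> + \<epsilon>) * d"
      using \<alpha>(2)[OF \<epsilon>] by blast
    obtain s where s: "0 < s"
      "\<And>c d. 0 < c \<Longrightarrow> 0 \<le> d \<Longrightarrow> d \<le> s * c \<Longrightarrow> N (c, d) \<le> c + (\<beta> + \<epsilon>) * d"
      using \<beta>(2)[OF \<epsilon>] by blast
    define l where "l = - right (- u)"
    have l: "M (l, u) = 1" "l < right u"
      using M_left[OF u] left_less_right[OF u] by (simp_all add: l_def)
    have lim: "(f \<longlongrightarrow> f u) (at_right u)" if "continuous_on heights f" for f :: "real \<Rightarrow> real"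
      using that u open_heights
      by (meson at_within_open continuous_on_def filterlim_at_split isCont_def continuous_on_eq_continuous_at)
    have limits: "((\<lambda>v. right v - l) \<longlongrightarrow> right u - l) (at_right u)"
      "((\<lambda>v. right u - l + X v - X u) \<longlongrightarrow> right u - l) (at_right u)"
      "((\<lambda>v. r * (right v - l) - (v - u)) \<longlongrightarrow> r * (right u - l)) (at_right u)"
      "((\<lambda>v. s * (right u - l + X v - X u) - (\<phi> v - \<phi> u)) \<longlongrightarrow> s * (right u - l)) (at_right u)"
      by (rule tendsto_eq_intros lim[OF continuous_right] lim[OF contX] lim[OF cont\<phi>] | simp)+
    have "\<forall>\<^sub>F v in at_right u. v \<in> heights"
      using open_heights u by (metis eventually_at_topological)
    moreover have "\<forall>\<^sub>F v in at_right u. u < v"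
      by (rule eventually_at_right_less)
    moreover have "\<forall>\<^sub>F v in at_right u. 0 < right v - l"
      using order_tendstoD(1)[OF limits(1), of 0] l by simp
    moreover have "\<forall>\<^sub>F v in at_right u. 0 < right u - l + X v - X u"
      using order_tendstoD(1)[OF limits(2), of 0] l by simp
    moreover have "\<forall>\<^sub>F v in at_right u. 0 < r * (right v - l) - (v - u)"
      using order_tendstoD(1)[OF limits(3), of 0] l r by simp
    moreover have "\<forall>\<^sub>F v in at_right u. 0 < s * (right u - l + X v - X u) - (\<phi> v - \<phi> u)"
      using order_tendstoD(1)[OF limits(4), of 0] l s by simp
    ultimately show ?thesis
    proof eventually_elim
      case (elim v)
      have mono: "0 \<le> \<phi> v - \<phi> u"
        using height_mono[of u v] u elim by (simp add: \<phi>_def)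
      have "h (right u, u) - h (l, u) = (right u - l, 0)"
        using horizontal M_right u l by blast
      then have "h (right v, v) - h (l, u) = (right u - l + X v - X u, \<phi> v - \<phi> u)"
        by (simp add: X_def \<phi>_def prod_eq_iff)
      then have eq: "N (right u - l + X v - X u, \<phi> v - \<phi> u) = M (right v - l, v - u)"
        using iso[OF M_right l(1), of v] elim by simp
      \<comment> \<open>The common length is squeezed by each of the two functionals up to an error.
        Comparing crosswise bounds the increment of \<open>G\<close>, which is the difference of
        their values.\<close>
      have "right v - l + \<alpha> * (v - u) \<le> M (right v - l, v - u)"
        "M (right v - l, v - u) \<le> right v - l + (\<alpha> + \<epsilon>) * (v - u)"
        "right u - l + X v - X u + \<beta> * (\<phi> v - \<phi> u) \<le> M (right v - l, v - u)"
        "M (right v - l, v - u) \<le> right u - l + X v - X u + (\<beta> + \<epsilon>) * (\<phi> v - \<phi> u)"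
        using \<alpha>(1)[of "right v - l" "v - u"] r(2)[of "right v - l" "v - u"]
          \<beta>(1)[of "right u - l + X v - X u" "\<phi> v - \<phi> u"]
          s(2)[of "right u - l + X v - X u" "\<phi> v - \<phi> u"] elim mono unfolding eq by simp_all
      moreover have "0 \<le> \<epsilon> * (v - u)" "0 \<le> \<epsilon> * (\<phi> v - \<phi> u)"
        using elim mono \<epsilon> by simp_all
      ultimately show ?case
        unfolding G_def abs_le_iff by (simp add: algebra_simps)
    qed
  qed
  have const: "G w = G u" if uw: "u \<in> heights" "w \<in> heights" "u \<le> w" for u w
  proof (rule ccontr)
    assume ne: "G w \<noteq> G u"
    \<comment> \<open>With \<open>k\<close> as comparison function the local bounds add up to
      \<open>\<bar>G w - G u\<bar> \<le> \<epsilon> * (k w - k u)\<close> for every positive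
      \<open>\<epsilon>\<close>, which forces equality.\<close>
    define k where "k v = v + \<phi> v" for v
    have k: "k u \<le> k w"
      using height_mono[OF uw] uw by (simp add: k_def \<phi>_def)
    have sub: "{u..w} \<subseteq> heights"
      by (rule heights_between[OF uw(1,2)])
    have cont: "continuous_on {u..w} G" "continuous_on {u..w} k"
      unfolding k_def using sub contG cont\<phi>
      by (auto intro!: continuous_intros intro: continuous_on_subset)
    have bound: "\<bar>G w - G u\<bar> \<le> \<epsilon> * (k w - k u)" if \<epsilon>: "0 < \<epsilon>" for \<epsilon>
    proof -
      have loc: "\<forall>\<^sub>F v in at_right x. \<bar>G v - G x\<bar> \<le> \<epsilon> * (k v - k x)" if "u \<le> x" "x < w" for x
        using local[OF subsetD[OF sub] \<epsilon>, of x] that by (simp add: k_def)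
      have "G w - \<epsilon> * k w \<le> G u - \<epsilon> * k u"
      proof (rule right_local_nonincreasing[OF uw(3)])
        show "\<forall>\<^sub>F v in at_right x. G v - \<epsilon> * k v \<le> G x - \<epsilon> * k x" if "u \<le> x" "x < w" for x
          using loc[OF that] by eventually_elim (simp add: algebra_simps abs_le_iff)
      qed (intro continuous_intros cont)
      moreover have "- G w - \<epsilon> * k w \<le> - G u - \<epsilon> * k u"
      proof (rule right_local_nonincreasing[OF uw(3)])
        show "\<forall>\<^sub>F v in at_right x. - G v - \<epsilon> * k v \<le> - G x - \<epsilon> * k x" if "u \<le> x" "x < w" for x
          using loc[OF that] by eventually_elim (simp add: algebra_simps abs_le_iff)
      qed (intro continuous_intros cont)
      ultimately show ?thesis
        by (simp add: algebra_simps abs_le_iff)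
    qed
    define \<epsilon> where "\<epsilon> = \<bar>G w - G u\<bar> / (2 * (k w - k u + 1))"
    have "0 < \<epsilon>"
      using ne k by (simp add: \<epsilon>_def)
    moreover have "\<epsilon> * (2 * (k w - k u + 1)) = \<bar>G w - G u\<bar>"
      using k by (simp add: \<epsilon>_def)
    moreover have "0 \<le> \<epsilon> * (k w - k u)"
      using k \<open>0 < \<epsilon>\<close> by simp
    ultimately show False
      using bound[of \<epsilon>] by (simp add: algebra_simps)
  qed
  have "G 0 = 0"
    by (simp add: G_def X_def \<phi>_def right_zero h1)
  then have G0: "G u = 0" if "u \<in> heights" for u
    using const[OF that zero_in_heights] const[OF zero_in_heights that] by linarith
  have transfer: "fst (h (a, u)) + \<beta> * snd (h (a, u)) = a + \<alpha> * u"
    if "M (a, u) = 1" "M (k, u) = 1" "fst (h (k, u)) + \<beta> * snd (h (k, u)) = k + \<alpha> * u" for a k u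
    using horizontal[OF that(1,2)] that(3) by (auto simp: prod_eq_iff)
  have chord: "fst (h (right u, u)) + \<beta> * snd (h (right u, u)) = right u + \<alpha> * u" if "u \<in> heights" for u
    using G0[OF that] by (simp add: G_def X_def \<phi>_def)
  have "fst (h (a, u)) + \<beta> * snd (h (a, u)) = a + \<alpha> * u" if au: "M (a, u) = 1" for a u
  proof (cases "u \<in> heights")
    case True
    then show ?thesis
      using transfer[OF au M_right chord] by blast
  next
    case False
    \<comment> \<open>At an extremal height the line does not enter the open disc. The heights
      \<open>t n * u\<close> approach it from inside; a subsequence of their right ends converges to
      a point of the circle at height \<open>u\<close>, from which the identity passes to
      \<open>(a, u)\<close>.\<close>
    define t where "t n = 1 - inverse (real (Suc n))" for n
    have t: "t \<longlonglongrightarrow> 1"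
      unfolding t_def using LIMSEQ_inverse_real_of_nat_add_minus[of 1] by simp
    have tu: "t n * u \<in> heights" for n
    proof -
      have "M (t n * a, t n * u) = \<bar>t n\<bar>"
        using M.scale[of "t n" "(a, u)"] au by simp
      also have "\<dots> < 1"
        by (simp add: t_def abs_less_iff field_simps)
      finally show ?thesis
        by (auto simp: heights_def)
    qed
    define q where "q n = (right (t n * u), t n * u)" for n
    have q: "M (q n) = 1" "fst (h (q n)) + \<beta> * snd (h (q n)) = fst (q n) + \<alpha> * snd (q n)" for n
      using M_right[OF tu] chord[OF tu] by (simp_all add: q_def)
    obtain c where c: "0 < c" "\<And>p. c * norm p \<le> M p"
      using M.coercive by blast
    have "norm (q n) \<le> 1 / c" for n
      using c(1) c(2)[of "q n"] q(1)[of n] by (simp add: field_simps)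
    then have "bounded (range q)"
      by (auto intro!: boundedI)
    then obtain p \<sigma> where \<sigma>: "strict_mono \<sigma>" "(q \<circ> \<sigma>) \<longlonglongrightarrow> p"
      using bounded_imp_convergent_subsequence by blast
    have qp: "(\<lambda>n. q (\<sigma> n)) \<longlonglongrightarrow> p"
      using \<sigma>(2) by (simp add: comp_def)
    have "(\<lambda>n. M (q (\<sigma> n))) \<longlonglongrightarrow> M p"
      using continuous_on_tendsto_compose[OF M.continuous qp, of UNIV] by simp
    then have Mp: "M p = 1"
      using q(1) by (simp add: LIMSEQ_const_iff)
    have hqp: "(\<lambda>n. h (q (\<sigma> n))) \<longlonglongrightarrow> h p"
      by (rule continuous_on_tendsto_compose[OF continuous_h qp]) (use Mp q(1) in auto)
    have "(\<lambda>n. t (\<sigma> n) * u) \<longlonglongrightarrow> 1 * u"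
      using LIMSEQ_subseq_LIMSEQ[OF t \<sigma>(1)] by (intro tendsto_intros) (simp add: comp_def)
    moreover have "(\<lambda>n. t (\<sigma> n) * u) \<longlonglongrightarrow> snd p"
      using tendsto_snd[OF qp] by (simp add: q_def)
    ultimately have "snd p = u"
      using LIMSEQ_unique by fastforce
    moreover have "fst (h p) + \<beta> * snd (h p) = fst p + \<alpha> * snd p"
    proof (rule LIMSEQ_unique)
      show "(\<lambda>n. fst (h (q (\<sigma> n))) + \<beta> * snd (h (q (\<sigma> n)))) \<longlonglongrightarrow> fst (h p) + \<beta> * snd (h p)"
        by (intro tendsto_intros hqp)
      show "(\<lambda>n. fst (h (q (\<sigma> n))) + \<beta> * snd (h (q (\<sigma> n)))) \<longlonglongrightarrow> fst p + \<alpha> * snd p"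
        unfolding q(2) by (intro tendsto_intros qp)
    qed
    ultimately show ?thesis
      using transfer[OF au, of "fst p"] Mp by (cases p) simp
  qed
  then show ?thesis
    using that[of \<alpha> \<beta>] \<alpha>(1) by force
qed

text \<open>The horizontal and vertical functionals give a linear system for the displacement with
  determinant \<open>1 - \<alpha> * \<alpha>'\<close>. The fixed points (0, 1) and (1, 0) yield
  equal slopes for \<open>M\<close> and \<open>N\<close>, and the slopes have modulus below 1
  because (1, 1) and (1, - 1) have norm below 2.\<close>

lemma identity_nonflat:
  assumes "M (1, 1) \<noteq> 2" "M (1, -1) \<noteq> 2" and p: "M p = 1"
  shows "h p = p"
proof -
  interpret swap: plane_isometry "\<lambda>p. M (prod.swap p)" "\<lambda>p. N (prod.swap p)" "\<lambda>p. prod.swap (h (prod.swap p))"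
    by (rule swap)
  have lt: "M (1, 1) < 2" "M (1, -1) < 2"
    using M.le_sum_abs[OF unit1 unit2, of 1 1] M.le_sum_abs[OF unit1 unit2, of 1 "-1"] assms
    by simp_all
  have minus: "M (- 1, 1) = M (1, - 1)"
    using M.minus[of "(1, -1)"] by simp
  obtain \<alpha> \<beta> where \<alpha>: "\<And>c d. 0 < c \<Longrightarrow> c + \<alpha> * d \<le> M (c, d)"
    "\<And>p. M p = 1 \<Longrightarrow> fst (h p) + \<beta> * snd (h p) = fst p + \<alpha> * snd p"
    using horizontal_functional by blast
  obtain \<alpha>' \<beta>' where \<alpha>': "\<And>c d. 0 < c \<Longrightarrow> c + \<alpha>' * d \<le> M (prod.swap (c, d))"
    "\<And>p. M (prod.swap p) = 1 \<Longrightarrow>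
      fst (prod.swap (h (prod.swap p))) + \<beta>' * snd (prod.swap (h (prod.swap p))) = fst p + \<alpha>' * snd p"
    using swap.horizontal_functional by blast
  have "\<beta> = \<alpha>" "\<beta>' = \<alpha>'"
    using \<alpha>(2)[OF unit2] \<alpha>'(2)[of "(0, 1)"] h1 h2 unit1 by simp_all
  then have "fst (h p) + \<alpha> * snd (h p) = fst p + \<alpha> * snd p"
    "snd (h p) + \<alpha>' * fst (h p) = snd p + \<alpha>' * fst p"
    using \<alpha>(2)[OF p] \<alpha>'(2)[of "prod.swap p"] p by simp_all
  then have eqs: "fst (h p) - fst p = \<alpha> * (snd p - snd (h p))"
    "snd p - snd (h p) = \<alpha>' * (fst (h p) - fst p)"
    by (simp_all add: algebra_simps)
  have "\<bar>\<alpha>\<bar> < 1" "\<bar>\<alpha>'\<bar> < 1"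
    using \<alpha>(1)[of 1 1] \<alpha>(1)[of 1 "-1"] \<alpha>'(1)[of 1 1] \<alpha>'(1)[of 1 "-1"] lt minus
    by (simp_all add: abs_less_iff)
  then have "\<bar>\<alpha> * \<alpha>'\<bar> < 1"
    by (metis abs_mult abs_mult_less mult_1)
  then have "\<alpha> * \<alpha>' \<noteq> 1"
    by auto
  moreover have "(fst (h p) - fst p) * (1 - \<alpha> * \<alpha>') = 0"
    using eqs by algebra
  ultimately have "fst (h p) = fst p"
    by simp
  then show ?thesis
    using eqs by (simp add: prod_eq_iff)
qed

end

section \<open>Unit circles containing a segment between the special points\<close>

context plane_isometry
begin

text \<open>Reflecting in the horizontal axis reduces the case \<open>M (1, - 1) = 2\<close> to the
  case \<open>M (1, 1) = 2\<close>.\<close>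

lemma reflect_vertical:
  "plane_isometry (\<lambda>p. M (fst p, - snd p)) (\<lambda>p. N (fst p, - snd p))
    (\<lambda>p. (fst (h (fst p, - snd p)), - snd (h (fst p, - snd p))))"
proof -
  have norm: "plane_norm (\<lambda>p. K (fst p, - snd p))" if "plane_norm K" for K
  proof -
    interpret plane_norm K by fact
    show ?thesis
    proof unfold_locales
      fix p q :: "real \<times> real" and c :: real
      show "K (fst (p + q), - snd (p + q)) \<le> K (fst p, - snd p) + K (fst q, - snd q)"
        using triangle[of "(fst p, - snd p)" "(fst q, - snd q)"] by simp
      show "K (fst (c *\<^sub>R p), - snd (c *\<^sub>R p)) = \<bar>c\<bar> * K (fst p, - snd p)"
        using scale[of c "(fst p, - snd p)"] by simp
      show "p = 0" if "K (fst p, - snd p) = 0"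
        using definite[OF that] by (simp add: prod_eq_iff)
    qed
  qed
  have pair: "(fst p - fst q, snd p - snd q) = p - q" for p q :: "real \<times> real"
    by (simp add: prod_eq_iff)
  show ?thesis
  proof (intro plane_isometry.intro plane_isometry_axioms.intro norm M.plane_norm_axioms N.plane_norm_axioms,
      goal_cases)
    case (3 p)
    then show ?case
      using h_unit by simp
  next
    case (4 p q)
    show ?case
      using iso[OF 4] by (simp add: pair)
  next
    case (7 a b a')
    then show ?case
      using horizontal[of a "- b" a'] by (simp add: prod_eq_iff)
  next
    case (8 a b b')
    then show ?case
      using vertical[of a "- b" "- b'"] by (simp add: prod_eq_iff)
  qed (simp_all add: unit1 M_minus_units h1 h_minus_units)
qed

lemma flat_N: "M (1, 1) = 2 \<Longrightarrow> N (1, 1) = 2"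
  using iso[OF unit1 M_minus_units(2)] by (simp add: h1 h_minus_units)

text \<open>Such a point has the maximal distance 2 from (- 1, 0) and from (0, - 1). So has its
  image, which puts the image on the same line; the distances to (1, 0) and (0, 1) then determine
  its place there.\<close>

lemma flat_fixed:
  assumes flat: "M (1, 1) = 2" and ab: "M (a, b) = 1" "a + b = 1"
  shows "h (a, b) = (a, b)"
proof -
  obtain x y where xy: "h (a, b) = (x, y)"
    by (cases "h (a, b)") auto
  have N1: "N (x, y) = 1"
    using h_unit[OF ab(1)] xy by simp
  have "M ((a, b) + (1, 0)) = 2" "M ((a, b) + (0, 1)) = 2"
    using M.triangle[of "(a, b)" "(1, 0)"] M.triangle[of "(a, b)" "(0, 1)"]
      M.flat_ge_sum[OF unit1 unit2 flat, of "a + 1" b] M.flat_ge_sum[OF unit1 unit2 flat, of a "b + 1"]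
      ab unit1 unit2 by simp_all
  then have "N ((x, y) + (1, 0)) = 2" "N ((x, y) + (0, 1)) = 2"
    using iso[OF ab(1) M_minus_units(1)] iso[OF ab(1) M_minus_units(2)] xy h_minus_units by simp_all
  then have add: "N (x + k, y) = 1 + k" "N (x, y + k) = 1 + k" if "0 \<le> k" for k
    using N.add_multiple[OF N1 N_units(1), of k] N.add_multiple[OF N1 N_units(2), of k] that by simp_all
  \<comment> \<open>An image with a negative coordinate is moved to an axis by adding a multiple of
    a unit vector; the norm is known there.\<close>
  have "\<bar>y\<bar> = 1 - x" if "x < 0"
    using add(1)[of "- x"] that N.scale[of y "(0, 1)"] N_units by simp
  moreover have "\<bar>x\<bar> = 1 - y" if "y < 0"
    using add(2)[of "- y"] that N.scale[of x "(1, 0)"] N_units by simp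
  moreover have "x + y = 1" if "0 \<le> x" "0 \<le> y"
    using N.flat_quadrant[OF N_units flat_N[OF flat] that] N1 by simp
  ultimately have sum: "x + y = 1"
    by linarith
  have "N (y *\<^sub>R (- 1, 1)) = M (b *\<^sub>R (- 1, 1))" "N (x *\<^sub>R (- 1, 1)) = M (a *\<^sub>R (- 1, 1))"
  proof -
    have "(x, y) - (1, 0) = y *\<^sub>R (- 1, 1)" "(a, b) - (1, 0) = b *\<^sub>R (- 1, 1)"
      "(0, 1) - (x, y) = x *\<^sub>R (- 1, 1)" "(0, 1) - (a, b) = a *\<^sub>R (- 1, 1)"
      using sum ab(2) by auto
    then show "N (y *\<^sub>R (- 1, 1)) = M (b *\<^sub>R (- 1, 1))" "N (x *\<^sub>R (- 1, 1)) = M (a *\<^sub>R (- 1, 1))"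
      using iso[OF ab(1) unit1] iso[OF unit2 ab(1)] xy h1 h2 by metis+
  qed
  moreover have "N (- 1, 1) = M (- 1, 1)" "0 < M (- 1, 1)"
    using iso[OF unit2 unit1] M.pos[of "(- 1, 1)"] by (simp_all add: h1 h2 zero_prod_def)
  ultimately have "\<bar>y\<bar> = \<bar>b\<bar>" "\<bar>x\<bar> = \<bar>a\<bar>"
    by (simp_all only: N.scale M.scale mult_right_cancel)
  then show ?thesis
    using sum ab(2) xy by (auto simp: abs_if split: if_splits)
qed

text \<open>Points of the closed first or third quadrant lie on the flat segment or its opposite,
  and these are fixed by \<open>flat_fixed\<close>, applied to \<open>h\<close> and to its
  reflection.\<close>

lemma flat_moved:
  assumes flat: "M (1, 1) = 2" and p: "M (a, b) = 1" "h (a, b) \<noteq> (a, b)"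
  shows "a * b < 0" "\<bar>a + b\<bar> < 1"
proof -
  interpret neg: plane_isometry M N "\<lambda>p. - h (- p)"
    by (rule reflect_origin)
  have m: "M (- a, - b) = 1"
    using M.minus[of "(a, b)"] p by simp
  have "a + b \<noteq> 1"
    using flat_fixed[OF flat p(1)] p(2) by blast
  moreover have "- a + - b \<noteq> 1"
    using neg.flat_fixed[OF flat m] p(2)
    by (metis neg_equal_iff_equal uminus_Pair minus_minus)
  moreover have "a + b \<le> 1" "- a + - b \<le> 1"
    using M.flat_ge_sum[OF unit1 unit2 flat] p(1) m by metis+
  moreover from calculation have "\<not> (0 \<le> a \<and> 0 \<le> b)" "\<not> (a \<le> 0 \<and> b \<le> 0)"
    using M.flat_quadrant[OF unit1 unit2 flat, of a b]
      M.flat_quadrant[OF unit1 unit2 flat, of "- a" "- b"] p(1) m by auto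
  ultimately show "\<bar>a + b\<bar> < 1" "a * b < 0"
    unfolding mult_less_0_iff by linarith+
qed

text \<open>
  The point is found by maximising \<open>a - b\<close> over the points \<open>(a, b)\<close> of the open second quadrant
  with displacement of length \<^term>\<open>m\<close>: the other end of its horizontal chord lies to the left
  and that of its vertical chord lies above, so by convexity they cannot both exist.
\<close>

lemma flat_moved_level:
  assumes flat: "M (1, 1) = 2" and m: "0 < m"
    and q: "M q = 1" "fst q < 0" "0 < snd q" "norm (h q - q) = m"
  obtains a b where "M (a, b) = 1" "a < 0" "0 < b" "norm (h (a, b) - (a, b)) = m"
    "\<And>x. M (x, b) = 1 \<Longrightarrow> x = a"
proof -
  \<comment> \<open>The closed quadrant makes \<open>K\<close> compact; \<open>moved\<close> puts
    its points into the open one.\<close>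
  define K where "K = {p. M p = 1 \<and> norm (h p - p) = m \<and> p \<in> {..0} \<times> {0..}}"
  have moved: "a * b < 0" "\<bar>a + b\<bar> < 1" if "M (a, b) = 1" "norm (h (a, b) - (a, b)) = m" for a b
    using flat_moved[OF flat that(1)] that m by force+
  have same: "norm (h (a', b') - (a', b')) = m"
    if "h (a, b) - h (a', b') = (a, b) - (a', b')" "norm (h (a, b) - (a, b)) = m" for a b a' b'
  proof -
    have "h (a', b') - (a', b') = h (a, b) - (a, b)"
      using that(1) by (auto simp: prod_eq_iff)
    then show ?thesis
      using that(2) by simp
  qed
  have "compact K"
  proof -
    have "closed {p. M p = 1}"
      by (intro closed_Collect_eq M.continuous continuous_intros)
    moreover have "closed ({..0::real} \<times> {0::real..})"
      by (intro closed_Times) auto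
    ultimately have "closed ({p. M p = 1} \<inter> ({..0} \<times> {0..}))"
      by (rule closed_Int)
    moreover have "continuous_on ({p. M p = 1} \<inter> ({..0} \<times> {0..})) (\<lambda>p. norm (h p - p))"
      by (intro continuous_intros continuous_on_subset[OF continuous_h]) auto
    ultimately have "closed ({p. M p = 1} \<inter> ({..0} \<times> {0..}) \<inter> (\<lambda>p. norm (h p - p)) -` {m})"
      by (intro continuous_closed_preimage) auto
    moreover have "K = {p. M p = 1} \<inter> ({..0} \<times> {0..}) \<inter> (\<lambda>p. norm (h p - p)) -` {m}"
      by (auto simp: K_def)
    ultimately have "closed K"
      by simp
    moreover have "bounded K"
    proof -
      obtain c where c: "0 < c" "\<And>p. c * norm p \<le> M p"
        using M.coercive by blast
      have "norm p \<le> 1 / c" if "p \<in> K" for p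
        using c(1) c(2)[of p] that by (simp add: K_def field_simps)
      then show ?thesis
        by (rule boundedI)
    qed
    ultimately show ?thesis
      by (simp add: compact_eq_bounded_closed)
  qed
  moreover have "q \<in> K"
    using q by (cases q) (auto simp: K_def)
  moreover have "continuous_on K (\<lambda>p. fst p - snd p)"
    by (intro continuous_intros)
  ultimately obtain p where p: "p \<in> K" "\<And>p'. p' \<in> K \<Longrightarrow> fst p' - snd p' \<le> fst p - snd p"
    using continuous_attains_sup[of K] by blast
  obtain a b where [simp]: "p = (a, b)"
    by (cases p)
  have ab: "M (a, b) = 1" "norm (h (a, b) - (a, b)) = m"
    using p(1) by (auto simp: K_def)
  then have sgn: "a < 0" "0 < b" "\<bar>a + b\<bar> < 1"
    using p(1) moved[OF ab] by (auto simp: K_def mult_less_0_iff)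
  have hor: "x \<le> a" if "M (x, b) = 1" for x
  proof -
    have "h (a, b) - h (x, b) = (a, b) - (x, b)"
      using horizontal[OF ab(1) that] by simp
    from this ab(2) have "norm (h (x, b) - (x, b)) = m"
      by (rule same)
    moreover from this have "x < 0"
      using moved[OF that] sgn by (auto simp: mult_less_0_iff)
    ultimately have "(x, b) \<in> K"
      using that sgn by (simp add: K_def)
    then show ?thesis
      using p(2) by fastforce
  qed
  have vert: "b \<le> y" if "M (a, y) = 1" for y
  proof -
    have "h (a, b) - h (a, y) = (a, b) - (a, y)"
      using vertical[OF ab(1) that] by simp
    from this ab(2) have "norm (h (a, y) - (a, y)) = m"
      by (rule same)
    moreover from this have "0 < y"
      using moved[OF that] sgn by (auto simp: mult_less_0_iff)
    ultimately have "(a, y) \<in> K"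
      using that sgn by (simp add: K_def)
    then show ?thesis
      using p(2) by fastforce
  qed
  have "x = a" if x: "M (x, b) = 1" for x
  proof (rule ccontr)
    assume "x \<noteq> a"
    then have xa: "x < a"
      using hor[OF x] by simp
    show False
    proof (cases "\<exists>y. y \<noteq> b \<and> M (a, y) = 1")
      case True
      then obtain y where y: "M (a, y) = 1" "b < y"
        using vert by force
      \<comment> \<open>The antidiagonal through \<open>(a, b)\<close> meets the segment from
        \<open>(x, b)\<close> to \<open>(a, y)\<close> at \<open>(a - k, b + k)\<close> and the line
        spanned by (1, 1) at \<open>(a + d, b - d)\<close>. The latter point is inside the open
        disc, hence so is \<open>(a, b)\<close>, which lies between them.\<close>
      define k where "k = (a - x) * (y - b) / (a - x + (y - b))"
      define s where "s = (y - b) / (a - x + (y - b))"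
      define d where "d = (b - a) / 2"
      have s: "0 < s" "s < 1" "s * (a - x) = k" "(1 - s) * (y - b) = k"
        using xa y by (auto simp: s_def k_def field_simps)
      have "0 < k"
        using xa y by (simp add: k_def)
      have "M (s *\<^sub>R (x, b) + (1 - s) *\<^sub>R (a, y)) \<le> 1"
        using M.convex_comb[of s "1 - s" "(x, b)" "(a, y)"] s x y by simp
      also have "s *\<^sub>R (x, b) + (1 - s) *\<^sub>R (a, y) = (a - k, b + k)"
        using s by (simp add: algebra_simps)
      finally have upper: "M (a - k, b + k) \<le> 1" .
      have "0 < d"
        using sgn by (simp add: d_def)
      have "M (a + d, b - d) = \<bar>a + b\<bar>"
      proof -
        have "(a + d, b - d) = ((a + b) / 2) *\<^sub>R (1, 1)"
          by (simp add: d_def field_simps)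
        then show ?thesis
          by (simp only: M.scale flat) simp
      qed
      then have "M ((1 - d / (d + k)) *\<^sub>R (a + d, b - d) + (d / (d + k)) *\<^sub>R (a - k, b + k)) < 1"
        using sgn \<open>0 < k\<close> upper \<open>0 < d\<close> by (intro M.lt_one_between) auto
      moreover have "(1 - d / (d + k)) *\<^sub>R (a + d, b - d) + (d / (d + k)) *\<^sub>R (a - k, b + k) = (a, b)"
      proof -
        have "d / (d + k) * (d + k) = d"
          using \<open>0 < d\<close> \<open>0 < k\<close> by simp
        then show ?thesis
          by (simp add: algebra_simps del: times_divide_eq_left times_divide_eq_right)
      qed
      ultimately show False
        using ab(1) by simp
    next
      case False
      \<comment> \<open>The vertical line through \<open>(a, b)\<close> misses the open disc, so no
        point of the circle has an abscissa of larger modulus, although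
        \<open>x < a < 0\<close>.\<close>
      then have "1 \<le> M (a, y)" for y
        using other_ordinate[of a y b] by force
      interpret swap: plane_isometry "\<lambda>p. M (prod.swap p)" "\<lambda>p. N (prod.swap p)" "\<lambda>p. prod.swap (h (prod.swap p))"
        by (rule swap)
      have "\<bar>x\<bar> \<le> \<bar>a\<bar>"
        using swap.M.height_bound[of a "(b, x)"] \<open>\<And>y. 1 \<le> M (a, y)\<close> x by simp
      then show False
        using xa sgn by simp
    qed
  qed
  then show ?thesis
    using that ab sgn by blast
qed

text \<open>On a path in the circle from the fixed point (0, 1) to \<open>p\<close> the displacement
  takes all lengths up to \<open>m\<close>. The levels \<open>m\<close> and \<open>m / 2\<close>
  both yield a point that is alone at its height, hence at the top of the circle, so the two points
  coincide.\<close>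

lemma identity_flat_quadrant:
  assumes flat: "M (1, 1) = 2" and p: "M p = 1" "fst p < 0" "0 < snd p"
  shows "h p = p"
proof (rule ccontr)
  assume "h p \<noteq> p"
  define m where "m = norm (h p - p)"
  have m: "0 < m"
    using \<open>h p \<noteq> p\<close> by (simp add: m_def)
  define P where "P r = r *\<^sub>R p + (0, 1 - r)" for r :: real
  have P: "fst (P r) \<le> 0" "0 < snd (P r)" if "r \<in> {0..1}" for r
  proof -
    have "fst (P r) = r * fst p" "snd (P r) = r * snd p + (1 - r)"
      by (simp_all add: P_def)
    moreover have "r * fst p \<le> 0" "0 \<le> r * snd p"
      using that p(2,3) by (simp_all add: mult_nonneg_nonpos)
    moreover have "0 < r * snd p" if "r = 1"
      using that p(3) by simp
    ultimately show "fst (P r) \<le> 0" "0 < snd (P r)"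
      using that by (cases "r = 1"; simp)+
  qed
  then have P0: "P r \<noteq> 0" if "r \<in> {0..1}" for r
    using that by force
  define Q where "Q r = P r /\<^sub>R M (P r)" for r
  have P_cont: "continuous_on {0..1} P"
    unfolding P_def by (intro continuous_intros)
  have "continuous_on {0..1} (\<lambda>r. norm (h (Q r) - Q r))"
    unfolding Q_def
    by (intro continuous_on_norm continuous_on_diff continuous_h_path M.continuous_normalize P_cont P0)
  moreover have "P 0 = (0, 1)" "P 1 = p"
    by (simp_all add: P_def prod_eq_iff)
  then have "Q 0 = (0, 1)" "Q 1 = p"
    using p unit2 by (simp_all add: Q_def)
  ultimately have level: "\<exists>r. 0 \<le> r \<and> r \<le> 1 \<and> norm (h (Q r) - Q r) = n" if "0 < n" "n \<le> m" for n
    using IVT'[of "\<lambda>r. norm (h (Q r) - Q r)" 0 n 1] that by (simp add: h2 m_def)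
  have ex: "\<exists>a b. M (a, b) = 1 \<and> a < 0 \<and> 0 < b \<and> norm (h (a, b) - (a, b)) = n \<and>
      (\<forall>x. M (x, b) = 1 \<longrightarrow> x = a)" if n: "0 < n" "n \<le> m" for n
  proof -
    obtain r where r: "r \<in> {0..1}" "norm (h (Q r) - Q r) = n"
      using level[OF n] by auto
    have MQ: "M (Q r) = 1"
      unfolding Q_def by (rule M.normalize[OF P0[OF r(1)]])
    have Q: "fst (Q r) \<le> 0" "0 < snd (Q r)"
      using P[OF r(1)] M.pos[OF P0[OF r(1)]]
      by (auto simp: Q_def intro!: mult_nonneg_nonpos)
    have "h (fst (Q r), snd (Q r)) \<noteq> (fst (Q r), snd (Q r))"
      using r(2) n(1) by auto
    then have "fst (Q r) * snd (Q r) < 0"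
      using flat_moved(1)[OF flat, of "fst (Q r)" "snd (Q r)"] MQ by simp
    then have "fst (Q r) < 0"
      using Q by (auto simp: mult_less_0_iff)
    then show ?thesis
      using flat_moved_level[OF flat n(1) MQ _ Q(2) r(2)] by metis
  qed
  obtain a b where ab: "M (a, b) = 1" "0 < b" "norm (h (a, b) - (a, b)) = m"
    "\<And>x. M (x, b) = 1 \<Longrightarrow> x = a"
    using ex[of m] m by blast
  obtain c d where cd: "M (c, d) = 1" "0 < d" "norm (h (c, d) - (c, d)) = m / 2"
    "\<And>x. M (x, d) = 1 \<Longrightarrow> x = c"
  proof -
    have "0 < m / 2" "m / 2 \<le> m"
      using m by simp_all
    then show ?thesis
      using ex[of "m / 2"] that by blast
  qed
  have top: "\<bar>snd q\<bar> \<le> \<bar>y\<bar>" if "\<And>z. M (z, y) = 1 \<Longrightarrow> z = x" "M q = 1" for x y q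
  proof (rule M.height_bound)
    show "1 \<le> M (z, y)" for z
      using other_abscissa[of z y x] that(1) by force
  qed (simp add: that)
  have "b = d"
    using top[of b a, OF ab(4) cd(1)] top[of d c, OF cd(4) ab(1)] ab(2) cd(2) by simp
  then have "a = c"
    using cd(4)[of a] ab(1) by simp
  then show False
    using \<open>b = d\<close> ab(3) cd(3) m by simp
qed

lemma identity_flat:
  assumes flat: "M (1, 1) = 2" and p: "M p = 1"
  shows "h p = p"
proof (rule ccontr)
  assume ne: "h p \<noteq> p"
  interpret neg: plane_isometry M N "\<lambda>p. - h (- p)"
    by (rule reflect_origin)
  have "fst p * snd p < 0"
    using flat_moved(1)[OF flat, of "fst p" "snd p"] p ne by simp
  then consider "fst p < 0" "0 < snd p" | "fst (- p) < 0" "0 < snd (- p)"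
    by (auto simp: mult_less_0_iff)
  then show False
    using identity_flat_quadrant[OF flat p] neg.identity_flat_quadrant[OF flat, of "- p"] p ne
    by cases (auto simp: M.minus)
qed

lemma h_identity:
  assumes p: "M p = 1"
  shows "h p = p"
proof -
  interpret refl: plane_isometry "\<lambda>p. M (fst p, - snd p)" "\<lambda>p. N (fst p, - snd p)"
    "\<lambda>p. (fst (h (fst p, - snd p)), - snd (h (fst p, - snd p)))"
    by (rule reflect_vertical)
  consider "M (1, 1) = 2" | "M (1, - 1) = 2" | "M (1, 1) \<noteq> 2" "M (1, - 1) \<noteq> 2"
    by blast
  then show ?thesis
  proof cases
    case 1
    then show ?thesis
      by (rule identity_flat) fact
  next
    case 2
    then show ?thesis
      using refl.identity_flat[of "(fst p, - snd p)"] p by (simp add: prod_eq_iff)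
  next
    case 3
    then show ?thesis
      by (rule identity_nonflat) fact
  qed
qed

end

section \<open>Coordinates\<close>

lemma dim_2_spanning:
  fixes e1 e2 :: "'a::real_vector"
  assumes dim: "dim (UNIV :: 'a set) = 2" and ind: "independent {e1, e2}" "e1 \<noteq> e2"
  obtains a b where "x = a *\<^sub>R e1 + b *\<^sub>R e2"
proof -
  obtain B where B: "finite B" "card B = 2" "span B = (UNIV :: 'a set)"
  proof -
    \<comment> \<open>The default value of \<open>dim\<close> is 0, so the value 2 comes from an
      actual basis.\<close>
    obtain B where B: "independent B" "span B = span (UNIV :: 'a set)" "card B = 2"
      using dim unfolding dim_def by (metis (mono_tags, lifting) someI_ex zero_neq_numeral)
    then have "finite B"
      using card.infinite by fastforce
    then show ?thesis
      using that B by simp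
  qed
  have "x \<in> span {e1, e2}"
  proof (rule ccontr)
    assume x: "x \<notin> span {e1, e2}"
    then have "independent (insert x {e1, e2})"
      using ind(1) by (rule independent_insertI)
    then have "card (insert x {e1, e2}) \<le> card B"
      using independent_span_bound[OF B(1)] B(3) by blast
    moreover have "x \<notin> {e1, e2}"
      using x by (meson span_base)
    ultimately show False
      using B(2) ind(2) by simp
  qed
  then show ?thesis
    using that by (auto simp: span_insert span_singleton algebra_simps)
qed

section \<open>Linear combinations in a normed space given by a carrier\<close>

locale carrier_normed_space =
  fixes Y :: "'b normed_structure"
  assumes normed: "real_normed_space Y"
begin

lemma
  shows add_closed [rule_format]: "\<forall>u\<in>carr Y. \<forall>v\<in>carr Y. add Y u v \<in> carr Y"
    and smul_closed [rule_format]: "\<forall>a. \<forall>u\<in>carr Y. smul Y a u \<in> carr Y"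
    and zero_closed: "zero Y \<in> carr Y"
    and add_assoc [rule_format]: "\<forall>u\<in>carr Y. \<forall>v\<in>carr Y. \<forall>w\<in>carr Y.
      add Y (add Y u v) w = add Y u (add Y v w)"
    and add_commute [rule_format]: "\<forall>u\<in>carr Y. \<forall>v\<in>carr Y. add Y u v = add Y v u"
    and zero_add [rule_format]: "\<forall>u\<in>carr Y. add Y (zero Y) u = u"
    and smul_add [rule_format]:
      "\<forall>a. \<forall>u\<in>carr Y. \<forall>v\<in>carr Y. smul Y a (add Y u v) = add Y (smul Y a u) (smul Y a v)"
    and add_smul [rule_format]:
      "\<forall>a b. \<forall>u\<in>carr Y. smul Y (a + b) u = add Y (smul Y a u) (smul Y b u)"
    and smul_smul [rule_format]: "\<forall>a b. \<forall>u\<in>carr Y. smul Y a (smul Y b u) = smul Y (a * b) u"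
    and one_smul [rule_format]: "\<forall>u\<in>carr Y. smul Y 1 u = u"
    and nrm_eq_zero [rule_format]: "\<forall>u\<in>carr Y. nrm Y u = 0 \<longleftrightarrow> u = zero Y"
    and nrm_smul [rule_format]: "\<forall>a. \<forall>u\<in>carr Y. nrm Y (smul Y a u) = \<bar>a\<bar> * nrm Y u"
    and nrm_add [rule_format]:
      "\<forall>u\<in>carr Y. \<forall>v\<in>carr Y. nrm Y (add Y u v) \<le> nrm Y u + nrm Y v"
  using normed unfolding real_normed_space_def by - (elim conjE, assumption)+

lemma nrm_zero: "nrm Y (zero Y) = 0"
  using nrm_eq_zero zero_closed by blast

lemma zero_smul: "u \<in> carr Y \<Longrightarrow> smul Y 0 u = zero Y"
  using nrm_smul[of u 0] nrm_eq_zero smul_closed by simp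

lemma smul_zero: "smul Y a (zero Y) = zero Y"
  using nrm_smul[OF zero_closed, of a] nrm_eq_zero[OF smul_closed[OF zero_closed]] nrm_zero by simp

lemma add_zero: "u \<in> carr Y \<Longrightarrow> add Y u (zero Y) = u"
  using zero_add add_commute zero_closed by simp

lemma diff_swap:
  assumes "u \<in> carr Y" "v \<in> carr Y"
  shows "diff Y u v = smul Y (- 1) (diff Y v u)"
  using assms
  by (simp add: diff_def smul_add smul_smul smul_closed one_smul) (rule add_commute, auto intro: smul_closed)

lemma add_diff:
  assumes "u \<in> carr Y" "v \<in> carr Y"
  shows "add Y (diff Y u v) v = u"
proof -
  have "add Y (smul Y (- 1) v) v = zero Y"
    using add_smul[of v "- 1" 1] assms by (simp add: one_smul zero_smul)
  then show ?thesis
    using assms by (simp add: diff_def add_assoc smul_closed add_zero)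
qed

lemma add_add_swap:
  assumes "u \<in> carr Y" "v \<in> carr Y" "u' \<in> carr Y" "v' \<in> carr Y"
  shows "add Y (add Y u v) (add Y u' v') = add Y (add Y u u') (add Y v v')"
proof -
  have "add Y v (add Y u' v') = add Y u' (add Y v v')"
    using assms by (metis add_assoc add_commute)
  then show ?thesis
    using assms by (simp add: add_assoc add_closed)
qed

definition comb :: "'b \<Rightarrow> 'b \<Rightarrow> real \<times> real \<Rightarrow> 'b" where
  "comb u v p = add Y (smul Y (fst p) u) (smul Y (snd p) v)"

context
  fixes u v
  assumes u: "u \<in> carr Y" and v: "v \<in> carr Y"
begin

lemma comb_closed: "comb u v p \<in> carr Y"
  by (simp add: comb_def add_closed smul_closed u v)

lemma comb_add: "add Y (comb u v p) (comb u v q) = comb u v (p + q)"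
  by (simp add: comb_def add_add_swap smul_closed u v add_smul)

lemma comb_smul: "smul Y c (comb u v p) = comb u v (c *\<^sub>R p)"
  by (simp add: comb_def smul_add smul_smul smul_closed u v)

lemma comb_diff: "diff Y (comb u v p) (comb u v q) = comb u v (p - q)"
  by (simp add: diff_def comb_smul comb_add)

lemma comb_zero: "comb u v 0 = zero Y"
  by (simp add: comb_def zero_smul u v zero_add zero_closed)

lemma comb_fst: "comb u v (a, 0) = smul Y a u"
  by (simp add: comb_def zero_smul u v add_zero smul_closed)

lemma comb_snd: "comb u v (0, b) = smul Y b v"
  by (simp add: comb_def zero_smul u v zero_add smul_closed)

lemma comb_units: "comb u v (1, 0) = u" "comb u v (0, 1) = v"
  by (simp_all add: comb_fst comb_snd one_smul u v)

lemma nrm_comb_norm_function: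
  assumes "\<And>p. comb u v p = zero Y \<Longrightarrow> p = 0"
  shows "plane_norm (\<lambda>p. nrm Y (comb u v p))"
proof unfold_locales
  fix p q c
  show "nrm Y (comb u v (p + q)) \<le> nrm Y (comb u v p) + nrm Y (comb u v q)"
    using nrm_add[OF comb_closed comb_closed] by (simp add: comb_add)
  show "nrm Y (comb u v (c *\<^sub>R p)) = \<bar>c\<bar> * nrm Y (comb u v p)"
    using nrm_smul[OF comb_closed] by (simp add: comb_smul)
  show "p = 0" if "nrm Y (comb u v p) = 0"
    using that assms nrm_eq_zero[OF comb_closed] by blast
qed

end

text \<open>Serves to prove independence in \<open>comb_zeroD\<close> and to put \<open>w\<close>
  into the plane of the images in \<open>img_surj\<close>.\<close>

lemma comb_solve:
  assumes u: "u \<in> carr Y" and v: "v \<in> carr Y" and "snd p \<noteq> 0"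
  shows "v = add Y (smul Y (1 / snd p) (comb u v p)) (smul Y (- fst p / snd p) u)"
proof -
  have "(0, 1) = (1 / snd p) *\<^sub>R p + (- fst p / snd p, 0)"
    using assms by (simp add: prod_eq_iff)
  then have "v = add Y (comb u v ((1 / snd p) *\<^sub>R p)) (comb u v (- fst p / snd p, 0))"
    using comb_units(2)[OF u v] comb_add[OF u v] by metis
  then show ?thesis
    by (simp add: comb_smul[OF u v] comb_fst[OF u v])
qed

lemma comb_zeroD:
  assumes u: "u \<in> carr Y" and v: "v \<in> carr Y" and nz: "u \<noteq> zero Y"
    and v_notin: "\<And>a. v \<noteq> smul Y a u" and eq: "comb u v p = zero Y"
  shows "p = 0"
proof -
  have "snd p = 0"
  proof (rule ccontr)
    assume "snd p \<noteq> 0"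
    then have "v = smul Y (- fst p / snd p) u"
      using comb_solve[OF u v, of p] by (simp add: eq smul_zero zero_add smul_closed u)
    then show False
      using v_notin by blast
  qed
  then have "p = (fst p, 0)"
    by (simp add: prod_eq_iff)
  then have "smul Y (fst p) u = zero Y"
    using eq comb_fst[OF u v] by metis
  then have "\<bar>fst p\<bar> * nrm Y u = 0"
    using nrm_smul[OF u] nrm_zero by metis
  then show ?thesis
    using nz nrm_eq_zero[OF u] \<open>snd p = 0\<close> by (simp add: prod_eq_iff)
qed

end

section \<open>The plane of the special points and its image\<close>

locale special_pair = carrier_normed_space Y for Y :: "'b normed_structure" +
  fixes f :: "'a::real_normed_vector \<Rightarrow> 'b" and e1 e2 :: 'a
  assumes f_iso: "sphere_isometry Y f"
    and special1: "special_wrt Y e1" and special2: "special_wrt Y e2"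
    and norm1: "norm e1 = 1" and norm2: "norm e2 = 1"
    and indep: "\<And>a b. a *\<^sub>R e1 + b *\<^sub>R e2 = 0 \<Longrightarrow> a = 0 \<and> b = 0"
    and spans: "\<And>x. \<exists>a b. x = a *\<^sub>R e1 + b *\<^sub>R e2"
begin

lemma f_closed: "norm x = 1 \<Longrightarrow> f x \<in> carr Y"
  and nrm_f: "norm x = 1 \<Longrightarrow> nrm Y (f x) = 1"
  using f_iso unfolding sphere_isometry_def usphere_def by (auto dest: bij_betwE)

lemma f_dist: "norm x = 1 \<Longrightarrow> norm y = 1 \<Longrightarrow> nrm Y (diff Y (f x) (f y)) = norm (x - y)"
  using f_iso unfolding sphere_isometry_def by simp

lemma f_inj: "norm x = 1 \<Longrightarrow> norm y = 1 \<Longrightarrow> f x = f y \<Longrightarrow> x = y"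
  using f_iso unfolding sphere_isometry_def bij_betw_def inj_on_def by simp

lemma f_surj: "w \<in> carr Y \<Longrightarrow> nrm Y w = 1 \<Longrightarrow> \<exists>x. norm x = 1 \<and> f x = w"
  using f_iso unfolding sphere_isometry_def bij_betw_def usphere_def by (force simp: set_eq_iff)

text \<open>Specialness only concerns differences that are nonnegative multiples of
  \<open>e\<close>; for negative \<open>c\<close> the ends are exchanged.\<close>

lemma special_chord:
  assumes e: "special_wrt Y e" "norm e = 1" and x: "norm x = 1" and y: "norm y = 1"
    and xy: "x - y = c *\<^sub>R e"
  shows "diff Y (f x) (f y) = smul Y c (f e)"
proof -
  have *: "diff Y (f x) (f y) = smul Y c (f e)"
    if "norm x = 1" "norm y = 1" "x - y = c *\<^sub>R e" "0 \<le> c" for x y c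
  proof -
    have c: "norm (x - y) = c"
      using that e(2) by simp
    show ?thesis
      using e(1)[unfolded special_wrt_def, rule_format, OF f_iso, of x y] that c f_dist[OF that(1,2)]
      by (simp add: e(2))
  qed
  show ?thesis
  proof (cases "0 \<le> c")
    case True
    then show ?thesis
      using * x y xy by blast
  next
    case False
    have "y - x = (- c) *\<^sub>R e"
      using xy by (metis minus_diff_eq scaleR_minus_left)
    then have "diff Y (f y) (f x) = smul Y (- c) (f e)"
      using False * x y by simp
    then show ?thesis
      using diff_swap[OF f_closed[OF x] f_closed[OF y]] smul_smul f_closed[OF e(2)] by simp
  qed
qed

lemma f_minus:
  assumes e: "special_wrt Y e" "norm e = 1"
  shows "f (- e) = smul Y (- 1) (f e)"
proof -
  have "diff Y (f (- e)) (f e) = smul Y (- 2) (f e)"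
    by (rule special_chord[OF e]) (simp_all add: e(2) scaleR_2)
  then have "f (- e) = add Y (smul Y (- 2) (f e)) (smul Y 1 (f e))"
    using add_diff[of "f (- e)" "f e"] f_closed e(2) one_smul by simp
  then show ?thesis
    using add_smul[of "f e" "- 2" 1] f_closed[OF e(2)] by simp
qed

definition vec :: "real \<times> real \<Rightarrow> 'a" where
  "vec p = fst p *\<^sub>R e1 + snd p *\<^sub>R e2"

lemma vec_linear: "vec (p + q) = vec p + vec q" "vec (p - q) = vec p - vec q" "vec (c *\<^sub>R p) = c *\<^sub>R vec p"
  by (simp_all add: vec_def algebra_simps)

lemma vec_eq_zero: "vec p = 0 \<Longrightarrow> p = 0"
  using indep[of "fst p" "snd p"] by (simp add: vec_def prod_eq_iff)

lemma vec_inj: "vec p = vec q \<Longrightarrow> p = q"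
  using vec_eq_zero[of "p - q"] by (simp add: vec_linear)

lemma vec_surj: "\<exists>p. vec p = x"
  using spans[of x] by (auto simp: vec_def)

lemma vec_units: "vec (1, 0) = e1" "vec (0, 1) = e2"
  by (simp_all add: vec_def)

lemma plane_norm_vec: "plane_norm (\<lambda>p. norm (vec p))"
  by unfold_locales (simp_all add: vec_linear norm_triangle_ineq vec_eq_zero)

lemma carr1: "f e1 \<in> carr Y" and carr2: "f e2 \<in> carr Y"
  by (simp_all add: f_closed norm1 norm2)

text \<open>Comparing norms, \<open>f e2\<close> would be the image of \<open>e1\<close> or
  \<open>- e1\<close>, against injectivity.\<close>

lemma f2_not_multiple: "f e2 \<noteq> smul Y a (f e1)"
proof
  assume eq: "f e2 = smul Y a (f e1)"
  then have "\<bar>a\<bar> = 1"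
    using nrm_smul[OF carr1, of a] nrm_f[OF norm1] nrm_f[OF norm2] by simp
  then have "f e2 = f e1 \<or> f e2 = f (- e1)"
    using eq f_minus[OF special1 norm1] one_smul[OF carr1] by (auto simp: abs_if split: if_splits)
  then have "e2 = e1 \<or> e2 = - e1"
    using f_inj norm1 norm2 by (metis norm_minus_cancel)
  then show False
    using indep[of 1 "- 1"] indep[of 1 1] by auto
qed

abbreviation img :: "real \<times> real \<Rightarrow> 'b" where
  "img \<equiv> comb (f e1) (f e2)"

lemma img_eq_zero: "img p = zero Y \<Longrightarrow> p = 0"
  using comb_zeroD[OF carr1 carr2 _ f2_not_multiple] nrm_f[OF norm1] nrm_zero by (metis zero_neq_one)

lemma img_inj: "img p = img q \<Longrightarrow> p = q"
  using img_eq_zero[of "p - q"] comb_diff[OF carr1 carr2, of p q] comb_diff[OF carr1 carr2, of p p]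
    comb_zero[OF carr1 carr2] by simp

text \<open>
  A vector outside the plane of \<^term>\<open>f e1\<close> and \<^term>\<open>f e2\<close> would yield a path on the unit
  sphere from \<^term>\<open>f e2\<close> to its opposite that avoids the images of \<^term>\<open>e1\<close> and
  \<^term>\<open>- e1\<close>. But these two points separate \<^term>\<open>e2\<close> from \<^term>\<open>- e2\<close> on the circle.
\<close>

lemma img_surj:
  assumes w: "w \<in> carr Y"
  shows "\<exists>p. img p = w"
proof (rule ccontr)
  assume notin: "\<nexists>p. img p = w"
  let ?c = "comb (f e2) w"
  have "w \<noteq> smul Y a (f e2)" for a
    using notin comb_snd[OF carr1 carr2, of a] by metis
  then have "plane_norm (\<lambda>p. nrm Y (?c p))"
    using comb_zeroD[OF carr2 w] nrm_f[OF norm2] nrm_zero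
    by (intro nrm_comb_norm_function carr2 w) (metis zero_neq_one)
  then interpret Q: plane_norm "\<lambda>p. nrm Y (?c p)" .
  interpret V: plane_norm "\<lambda>p. norm (vec p)"
    by (rule plane_norm_vec)
  have "\<exists>q. norm (vec q) = 1 \<and> f (vec q) = ?c p" if "nrm Y (?c p) = 1" for p
    using f_surj[OF comb_closed[OF carr2 w] that] vec_surj by metis
  \<comment> \<open>\<open>G\<close> is the inverse of \<open>f\<close> in coordinates, restricted
    to the plane of \<open>f e2\<close> and \<open>w\<close>; being an isometry, it is
    continuous.\<close>
  then obtain G where G: "\<And>p. nrm Y (?c p) = 1 \<Longrightarrow> norm (vec (G p)) = 1"
    "\<And>p. nrm Y (?c p) = 1 \<Longrightarrow> f (vec (G p)) = ?c p"
    by metis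
  have contG: "continuous_on {p. nrm Y (?c p) = 1} G"
  proof (rule norm_isometry_continuous[OF Q.norm_function_axioms V.norm_function_axioms])
    fix p q assume "p \<in> {p. nrm Y (?c p) = 1}" "q \<in> {p. nrm Y (?c p) = 1}"
    then show "norm (vec (G p - G q)) = nrm Y (?c (p - q))"
      using f_dist[OF G(1) G(1), of p q] G(2) comb_diff[OF carr2 w] by (simp add: vec_linear)
  qed
  \<comment> \<open>In these coordinates \<open>P\<close> runs from the opposite of
    \<open>f e2\<close> through \<open>w\<close> to \<open>f e2\<close>.\<close>
  define P where "P r = (r, 1 - \<bar>r\<bar>)" for r :: real
  have P0: "P r \<noteq> 0" for r
    by (auto simp: P_def prod_eq_iff)
  define q where "q r = P r /\<^sub>R nrm Y (?c (P r))" for r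
  have q1: "nrm Y (?c (q r)) = 1" for r
    unfolding q_def by (rule Q.normalize[OF P0])
  have "continuous_on {- 1..1} q"
    unfolding q_def by (intro Q.continuous_normalize P0) (auto simp: P_def intro!: continuous_intros)
  then have "continuous_on {- 1..1} (\<lambda>r. snd (G (q r)))"
    by (intro continuous_on_snd continuous_on_compose2[OF contG]) (auto simp: q1)
  moreover have "snd (G (q 1)) = 1" "snd (G (q (- 1))) = - 1"
  proof -
    have "?c (P 1) = f e2" "?c (P (- 1)) = f (- e2)"
      using f_minus[OF special2 norm2] by (simp_all add: P_def comb_fst[OF carr2 w] one_smul carr2)
    then have "q 1 = P 1" "q (- 1) = P (- 1)" "?c (P 1) = f e2" "?c (P (- 1)) = f (- e2)"
      using nrm_f norm2 by (simp_all add: q_def)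
    then have "f (vec (G (q 1))) = f e2" "f (vec (G (q (- 1)))) = f (- e2)"
      using G(2)[OF q1, of 1] G(2)[OF q1, of "- 1"] by simp_all
    then have "vec (G (q 1)) = e2" "vec (G (q (- 1))) = - e2"
      using f_inj G(1)[OF q1] norm2 by simp_all
    then have "vec (G (q 1)) = vec (0, 1)" "vec (G (q (- 1))) = vec (0, - 1)"
      by (simp_all add: vec_def)
    then show "snd (G (q 1)) = 1" "snd (G (q (- 1))) = - 1"
      by (auto dest: vec_inj)
  qed
  ultimately obtain r where r: "- 1 \<le> r" "r \<le> 1" "snd (G (q r)) = 0"
    using IVT'[of "\<lambda>r. snd (G (q r))" "- 1" 0 1] by auto
  have "\<bar>r\<bar> \<noteq> 1"
    using r(3) \<open>snd (G (q 1)) = 1\<close> \<open>snd (G (q (- 1))) = - 1\<close> by (auto simp: abs_if split: if_splits)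
  then have nz: "snd (q r) \<noteq> 0"
    using Q.pos[OF P0, of r] by (simp add: q_def P_def)
  \<comment> \<open>At the zero of the second coordinate the preimage is \<open>e1\<close> or
    \<open>- e1\<close>. As the coefficient of \<open>w\<close> is nonzero there, \<open>w\<close>
    can be expressed by \<open>f e1\<close> and \<open>f e2\<close>.\<close>
  define x where "x = fst (G (q r))"
  have v: "vec (G (q r)) = x *\<^sub>R e1"
    using r(3) by (simp add: vec_def x_def)
  then have "\<bar>x\<bar> = 1"
    using G(1)[OF q1, of r] norm1 by simp
  then have "f (x *\<^sub>R e1) = smul Y x (f e1)"
    using f_minus[OF special1 norm1] one_smul[OF carr1] by (auto simp: abs_if split: if_splits)
  then have "?c (q r) = smul Y x (f e1)"
    using v G(2)[OF q1, of r] by simp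
  then have "w = add Y (smul Y (1 / snd (q r)) (smul Y x (f e1))) (smul Y (- fst (q r) / snd (q r)) (f e2))"
    using comb_solve[OF carr2 w nz] by simp
  then have "w = img (x / snd (q r), - fst (q r) / snd (q r))"
    by (simp add: comb_def smul_smul carr1)
  then show False
    using notin by metis
qed

lemma f_vec:
  assumes "norm (vec p) = 1"
  shows "f (vec p) = img p"
proof -
  \<comment> \<open>\<open>h\<close> is \<open>f\<close> read in coordinates: a suitable
    \<open>q\<close> exists on the circle by \<open>img_surj\<close> and is unique by
    \<open>img_inj\<close>.\<close>
  define h where "h p = (SOME q. f (vec p) = img q)" for p
  have h: "f (vec p) = img (h p)" if "norm (vec p) = 1" for p
    unfolding h_def using img_surj[OF f_closed[OF that]] by (metis (mono_tags) someI_ex)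
  have h_eq: "h p = q" if "norm (vec p) = 1" "f (vec p) = img q" for p q
    using h[OF that(1)] that(2) img_inj by metis
  have h_diff: "img (h p - h q) = diff Y (f (vec p)) (f (vec q))"
    if "norm (vec p) = 1" "norm (vec q) = 1" for p q
    using h that comb_diff[OF carr1 carr2] by simp
  interpret plane_isometry "\<lambda>p. norm (vec p)" "\<lambda>p. nrm Y (img p)" h
  proof (intro plane_isometry.intro plane_isometry_axioms.intro plane_norm_vec
      nrm_comb_norm_function carr1 carr2)
    show "h (1, 0) = (1, 0)" "h (0, 1) = (0, 1)"
      using comb_units[OF carr1 carr2] by (auto intro!: h_eq simp: vec_units norm1 norm2)
    show "h (a, b) - h (a', b) = (a - a', 0)"
      if "norm (vec (a, b)) = 1" "norm (vec (a', b)) = 1" for a b a'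
    proof (rule img_inj)
      have "vec (a, b) - vec (a', b) = (a - a') *\<^sub>R e1"
        by (simp add: vec_def algebra_simps)
      then show "img (h (a, b) - h (a', b)) = img (a - a', 0)"
        using special_chord[OF special1 norm1 that] h_diff[OF that] comb_fst[OF carr1 carr2] by simp
    qed
    show "h (a, b) - h (a, b') = (0, b - b')"
      if "norm (vec (a, b)) = 1" "norm (vec (a, b')) = 1" for a b b'
    proof (rule img_inj)
      have "vec (a, b) - vec (a, b') = (b - b') *\<^sub>R e2"
        by (simp add: vec_def algebra_simps)
      then show "img (h (a, b) - h (a, b')) = img (0, b - b')"
        using special_chord[OF special2 norm2 that] h_diff[OF that] comb_snd[OF carr1 carr2] by simp
    qed
    show "nrm Y (img (h p)) = 1" if "norm (vec p) = 1" for p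
      using h[OF that] nrm_f[OF that] by simp
    show "nrm Y (img (h p - h q)) = norm (vec (p - q))"
      if "norm (vec p) = 1" "norm (vec q) = 1" for p q
      using h_diff[OF that] f_dist[OF that] by (simp add: vec_linear)
  qed (simp_all add: vec_units norm1 norm2 img_eq_zero)
  show ?thesis
    using h[OF assms] h_identity[OF assms] by simp
qed

text \<open>The extension keeps coordinates. It agrees with \<open>f\<close> on the sphere, and
  homogeneity then makes it preserve all norms.\<close>

lemma linear_extension: "\<exists>F. linear_isometry Y F \<and> (\<forall>u\<in>sphere 0 1. F u = f u)"
proof -
  obtain C where C: "\<And>x. vec (C x) = x"
    using vec_surj by metis
  have C_vec: "C (vec p) = p" for p
    using vec_inj C by blast
  have C_add: "C (u + v) = C u + C v" and C_scale: "C (a *\<^sub>R u) = a *\<^sub>R C u" for u v a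
    by (rule vec_inj; simp add: C vec_linear)+
  have F_f: "img (C u) = f u" if "norm u = 1" for u
    using f_vec[of "C u"] C that by simp
  have F_scale: "img (C (a *\<^sub>R u)) = smul Y a (img (C u))" for a u
    by (simp add: C_scale comb_smul[OF carr1 carr2])
  have "nrm Y (img (C u)) = norm u" for u
  proof (cases "u = 0")
    case True
    then show ?thesis
      using C_scale[of 0 0] comb_zero[OF carr1 carr2] nrm_zero by simp
  next
    case False
    then have "img (C u) = smul Y (norm u) (f (u /\<^sub>R norm u))"
      using F_scale[of "norm u" "u /\<^sub>R norm u"] F_f[of "u /\<^sub>R norm u"] by simp
    then show ?thesis
      using False nrm_smul f_closed nrm_f by simp
  qed
  moreover have "bij_betw (\<lambda>u. img (C u)) UNIV (carr Y)"
  proof (rule bij_betwI')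
    show "img (C u) = img (C v) \<longleftrightarrow> u = v" for u v
      using img_inj C by metis
    show "img (C u) \<in> carr Y" for u
      by (rule comb_closed[OF carr1 carr2])
    show "\<exists>u\<in>UNIV. w = img (C u)" if "w \<in> carr Y" for w
      using img_surj[OF that] C_vec by (metis UNIV_I)
  qed
  moreover have "img (C (u + v)) = add Y (img (C u)) (img (C v))" for u v
    by (simp add: C_add comb_add[OF carr1 carr2])
  ultimately show ?thesis
    unfolding linear_isometry_def using F_scale F_f by (intro exI[of _ "\<lambda>u. img (C u)"]) simp
qed

end

theorem proposition4p7:
  assumes "dim (UNIV :: 'a::banach set) = 2"
    and "\<exists>x y :: 'a. special x \<and> special y \<and> x \<noteq> y \<and> independent {x, y}"
  shows "mazur_ulam_property TYPE('a) TYPE('b)"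
proof -
  obtain x y :: 'a where xy: "special x" "special y" "x \<noteq> y" "independent {x, y}"
    using assms(2) by blast
  have indep: "a = 0 \<and> b = 0" if "a *\<^sub>R x + b *\<^sub>R y = 0" for a b
  proof -
    have "(\<Sum>v\<in>{x, y}. (if v = x then a else b) *\<^sub>R v) = 0"
      using that xy(3) by simp
    then show ?thesis
      using independentD[OF xy(4), of "{x, y}" "\<lambda>v. if v = x then a else b"] xy(3) by fastforce
  qed
  have "special_pair Y f x y" if "banach_space Y" "sphere_isometry Y f" for Y :: "'b normed_structure" and f
  proof
    show "real_normed_space Y"
      using that(1) by (simp add: banach_space_def)
    \<comment> \<open>\<open>special\<close> speaks of carriers in the type of \<open>X\<close>; the
      transfer theorem passes to carriers in \<open>'b\<close>.\<close>
    show "special_wrt Y x" "special_wrt Y y"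
      using special_imp_special_wrt xy(1,2) that(1) by blast+
    show "norm x = 1" "norm y = 1"
      using xy(1,2) by (simp_all add: special_def)
    show "\<exists>a b. u = a *\<^sub>R x + b *\<^sub>R y" for u
      using dim_2_spanning[OF assms(1) xy(4,3)] by metis
  qed (use that indep in auto)
  then show ?thesis
    unfolding mazur_ulam_property_def using special_pair.linear_extension by blast
qed

end
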